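(* Let $V_1,\dots,V_l,W_1,\dots,W_l,U,Q$ be finite dimensional $k$-vector spaces. (a) If a linear transformation $T:\bigoplus_{i=1}^{l}(V_i\otimes W_i)\to U$ is surjective, then it satisfies the left omnipresent (respectively, left general) maximal rank property if and only if so does the inclusion $\operatorname{Ker}T\to\bigoplus_{i=1}^{l}(V_i\otimes W_i)$. (b) If a linear transformation $S:Q\to\bigoplus_{i=1}^{l}(V_i\otimes W_i)$ is injective, then it satisfies the left omnipresent (respectively, left general) maximal rank property if and only if so does the projection $\bigoplus_{i=1}^{l}(V_i\otimes W_i)\to\operatorname{Coker}S$.
   Context: $k$ is a fixed algebraically closed field; $\otimes$ is over $k$. A linear map has maximal rank if it is injective or surjective. A linear transformation $T$ from $\bigoplus_i(V_i\otimes W_i)$ to a finite dimensional space satisfies the left omnipresent maximal rank property if for every choice of subspaces $V'_i\subset V_i$, $i=1,\dots,l$, the restriction of $T$ to $\bigoplus_i(V'_i\otimes W_i)$ has maximal rank; it satisfies the left general maximal rank property if this restriction has maximal rank for a general choice of subspaces $V'_i\subset V_i$. A linear transformation $S$ from a finite dimensional space to $\bigoplus_i(V_i\otimes W_i)$ satisfies the left omnipresent maximal rank property if for every choice of subspaces $V'_i\subset V_i$ the composition of $S$ with $\bigoplus_i(\sigma_i\otimes 1_{W_i}):\bigoplus_i(V_i\otimes W_i)\to\bigoplus_i((V_i/V'_i)\otimes W_i)$ has maximal rank, where $\sigma_i:V_i\to V_i/V'_i$ is the natural projection; it satisfies the left general maximal rank property if this composition has maximal rank for a general choice of subspaces $V'_i\subset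 V_i$. "For a general choice of subspaces" means: once the dimensions of the $V'_i$ are fixed (arbitrarily), there is a dense Zariski open subset of the corresponding product of Grassmannians such that the assertion holds whenever $(V'_1,\dots,V'_l)$ belongs to it. *)

theory Defs
  imports
    "Jordan_Normal_Form.Missing_VectorSpace"
    "HOL-Algebra.Algebraic_Closure"
    "HOL-Analysis.Abstract_Topology"
    "HOL-Combinatorics.Permutations"
begin

section \<open>Quotients and finite direct sums\<close>

text \<open>The components \<^const>\<open>monoid.mult\<close> and \<^const>\<open>monoid.one\<close> of a module record carry no
  information; they are filled with zero, as in \<^const>\<open>direct_sum\<close>. Linear maps
  are functions whose values off the carrier are irrelevant.\<close>

definition quotient_space :: "('k, 'v) module \<Rightarrow> 'v set \<Rightarrow> ('k, 'v set) module" where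
  "quotient_space V N =
    \<lparr>carrier = a_rcosets\<^bsub>V\<^esub> N,
     monoid.mult = (\<lambda>A B. N), one = N, zero = N,
     add = (\<lambda>A B. A <+>\<^bsub>V\<^esub> B),
     smult = (\<lambda>c A. N <+>\<^bsub>V\<^esub> ((\<lambda>v. c \<odot>\<^bsub>V\<^esub> v) ` A))\<rparr>"

definition quotient_proj :: "('k, 'v) module \<Rightarrow> 'v set \<Rightarrow> 'v \<Rightarrow> 'v set" where
  "quotient_proj V N v = N +>\<^bsub>V\<^esub> v"

definition direct_sum_fam :: "'i set \<Rightarrow> ('i \<Rightarrow> ('k, 'v) module) \<Rightarrow> ('k, 'i \<Rightarrow> 'v) module" where
  "direct_sum_fam I M =
    \<lparr>carrier = (\<Pi>\<^sub>E i\<in>I. carrier (M i)),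
     monoid.mult = (\<lambda>x y. \<lambda>i\<in>I. \<zero>\<^bsub>M i\<^esub>), one = (\<lambda>i\<in>I. \<zero>\<^bsub>M i\<^esub>), zero = (\<lambda>i\<in>I. \<zero>\<^bsub>M i\<^esub>),
     add = (\<lambda>x y. \<lambda>i\<in>I. x i \<oplus>\<^bsub>M i\<^esub> y i),
     smult = (\<lambda>c x. \<lambda>i\<in>I. c \<odot>\<^bsub>M i\<^esub> x i)\<rparr>"

definition direct_sum_map :: "'i set \<Rightarrow> ('i \<Rightarrow> 'v \<Rightarrow> 'w) \<Rightarrow> ('i \<Rightarrow> 'v) \<Rightarrow> ('i \<Rightarrow> 'w)" where
  "direct_sum_map I f x = (\<lambda>i\<in>I. f i (x i))"


section \<open>Tensor products\<close>

definition free_space :: "('k, 'm) ring_scheme \<Rightarrow> 'x set \<Rightarrow> ('k, 'x \<Rightarrow> 'k) module" where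
  "free_space K B = (ring.func_space K B)
    \<lparr>carrier := {f \<in> B \<rightarrow>\<^sub>E carrier K. finite {x \<in> B. f x \<noteq> \<zero>\<^bsub>K\<^esub>}}\<rparr>"

definition free_gen :: "('k, 'm) ring_scheme \<Rightarrow> 'x set \<Rightarrow> 'x \<Rightarrow> 'x \<Rightarrow> 'k" where
  "free_gen K B x = (\<lambda>y\<in>B. if y = x then \<one>\<^bsub>K\<^esub> else \<zero>\<^bsub>K\<^esub>)"

text \<open>\<open>V \<otimes> W\<close> is the free vector space on the set \<open>V \<times> W\<close> modulo the span of the
  bilinearity relations.\<close>

definition bilinear_relations ::
    "('k, 'm) ring_scheme \<Rightarrow> ('k, 'v) module \<Rightarrow> ('k, 'w) module \<Rightarrow> ('v \<times> 'w \<Rightarrow> 'k) set" where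
  "bilinear_relations K V W =
    (let F = free_space K (carrier V \<times> carrier W);
         \<delta> = (\<lambda>v w. free_gen K (carrier V \<times> carrier W) (v, w))
     in {\<delta> (v \<oplus>\<^bsub>V\<^esub> v') w \<ominus>\<^bsub>F\<^esub> (\<delta> v w \<oplus>\<^bsub>F\<^esub> \<delta> v' w) | v v' w.
           v \<in> carrier V \<and> v' \<in> carrier V \<and> w \<in> carrier W}
      \<union> {\<delta> v (w \<oplus>\<^bsub>W\<^esub> w') \<ominus>\<^bsub>F\<^esub> (\<delta> v w \<oplus>\<^bsub>F\<^esub> \<delta> v w') | v w w'.
           v \<in> carrier V \<and> w \<in> carrier W \<and> w' \<in> carrier W}
      \<union> {\<delta> (c \<odot>\<^bsub>V\<^esub> v) w \<ominus>\<^bsub>F\<^esub> (c \<odot>\<^bsub>F\<^esub> \<delta> v w) | c v w.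
           c \<in> carrier K \<and> v \<in> carrier V \<and> w \<in> carrier W}
      \<union> {\<delta> v (c \<odot>\<^bsub>W\<^esub> w) \<ominus>\<^bsub>F\<^esub> (c \<odot>\<^bsub>F\<^esub> \<delta> v w) | c v w.
           c \<in> carrier K \<and> v \<in> carrier V \<and> w \<in> carrier W})"

definition tensor_null ::
    "('k, 'm) ring_scheme \<Rightarrow> ('k, 'v) module \<Rightarrow> ('k, 'w) module \<Rightarrow> ('v \<times> 'w \<Rightarrow> 'k) set" where
  "tensor_null K V W =
    LinearCombinations.module.span K (free_space K (carrier V \<times> carrier W)) (bilinear_relations K V W)"

definition tensor_space ::
    "('k, 'm) ring_scheme \<Rightarrow> ('k, 'v) module \<Rightarrow> ('k, 'w) module \<Rightarrow> ('k, ('v \<times> 'w \<Rightarrow> 'k) set) module" where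
  "tensor_space K V W =
    quotient_space (free_space K (carrier V \<times> carrier W)) (tensor_null K V W)"

definition pure_tensor ::
    "('k, 'm) ring_scheme \<Rightarrow> ('k, 'v) module \<Rightarrow> ('k, 'w) module \<Rightarrow> 'v \<Rightarrow> 'w \<Rightarrow> ('v \<times> 'w \<Rightarrow> 'k) set" where
  "pure_tensor K V W v w =
    quotient_proj (free_space K (carrier V \<times> carrier W)) (tensor_null K V W)
      (free_gen K (carrier V \<times> carrier W) (v, w))"

text \<open>\<open>f \<otimes> 1\<^sub>W : V \<otimes> W \<rightarrow> V' \<otimes> W\<close> for a linear map \<open>f : V \<rightarrow> V'\<close>: the linear map
  sending \<open>v \<otimes> w\<close> to \<open>f v \<otimes> w\<close>. It is unique on the carrier because pure tensors span, and
  unique as a function by extensionality.\<close>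

definition tensor_map ::
    "('k, 'm) ring_scheme \<Rightarrow> ('k, 'v) module \<Rightarrow> ('k, 'v') module \<Rightarrow> ('k, 'w) module \<Rightarrow> ('v \<Rightarrow> 'v')
      \<Rightarrow> ('v \<times> 'w \<Rightarrow> 'k) set \<Rightarrow> ('v' \<times> 'w \<Rightarrow> 'k) set" where
  "tensor_map K V V' W f =
    (THE h. h \<in> LinearCombinations.module_hom K (tensor_space K V W) (tensor_space K V' W)
          \<inter> extensional (carrier (tensor_space K V W))
        \<and> (\<forall>v\<in>carrier V. \<forall>w\<in>carrier W. h (pure_tensor K V W v w) = pure_tensor K V' W (f v) w))"

definition tensor_sum ::
    "('k, 'm) ring_scheme \<Rightarrow> nat \<Rightarrow> (nat \<Rightarrow> ('k, 'v) module) \<Rightarrow> (nat \<Rightarrow> ('k, 'w) module)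
      \<Rightarrow> ('k, nat \<Rightarrow> ('v \<times> 'w \<Rightarrow> 'k) set) module" where
  "tensor_sum K l V W = direct_sum_fam {1..l} (\<lambda>i. tensor_space K (V i) (W i))"

definition tensor_sum_map ::
    "('k, 'm) ring_scheme \<Rightarrow> nat \<Rightarrow> (nat \<Rightarrow> ('k, 'v) module) \<Rightarrow> (nat \<Rightarrow> ('k, 'v') module)
      \<Rightarrow> (nat \<Rightarrow> ('k, 'w) module) \<Rightarrow> (nat \<Rightarrow> 'v \<Rightarrow> 'v')
      \<Rightarrow> (nat \<Rightarrow> ('v \<times> 'w \<Rightarrow> 'k) set) \<Rightarrow> nat \<Rightarrow> ('v' \<times> 'w \<Rightarrow> 'k) set" where
  "tensor_sum_map K l V V' W f =
    direct_sum_map {1..l} (\<lambda>i. tensor_map K (V i) (V' i) (W i) (f i))"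


section \<open>Products of Grassmannians and their Zariski topology\<close>

definition subspace_families ::
    "('k, 'm) ring_scheme \<Rightarrow> nat \<Rightarrow> (nat \<Rightarrow> ('k, 'v) module) \<Rightarrow> (nat \<Rightarrow> 'v set) set" where
  "subspace_families K l V = (\<Pi>\<^sub>E i\<in>{1..l}. {V'. VectorSpace.subspace K V' (V i)})"

definition grassmannian_product ::
    "('k, 'm) ring_scheme \<Rightarrow> nat \<Rightarrow> (nat \<Rightarrow> ('k, 'v) module) \<Rightarrow> (nat \<Rightarrow> nat) \<Rightarrow> (nat \<Rightarrow> 'v set) set" where
  "grassmannian_product K l V d =
    {V' \<in> subspace_families K l V. \<forall>i\<in>{1..l}. vectorspace.dim K ((V i)\<lparr>carrier := V' i\<rparr>) = d i}"

definition linear_forms :: "('k, 'm) ring_scheme \<Rightarrow> ('k, 'v) module \<Rightarrow> ('v \<Rightarrow> 'k) set" where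
  "linear_forms K V = {\<phi> \<in> carrier V \<rightarrow> carrier K.
     (\<forall>x\<in>carrier V. \<forall>y\<in>carrier V. \<phi> (x \<oplus>\<^bsub>V\<^esub> y) = \<phi> x \<oplus>\<^bsub>K\<^esub> \<phi> y) \<and>
     (\<forall>c\<in>carrier K. \<forall>x\<in>carrier V. \<phi> (c \<odot>\<^bsub>V\<^esub> x) = c \<otimes>\<^bsub>K\<^esub> \<phi> x)}"

text \<open>The Plucker coordinate \<open>(\<phi>\<^sub>0 \<and> \<dots> \<and> \<phi>\<^sub>d\<^sub>-\<^sub>1)(b\<^sub>0 \<and> \<dots> \<and> b\<^sub>d\<^sub>-\<^sub>1) = det (\<phi>\<^sub>r (b\<^sub>s))\<close> of the span of
  \<open>b\<^sub>0, \<dots>, b\<^sub>d\<^sub>-\<^sub>1\<close>. Letting \<open>\<phi>\<close> range over all tuples of linear forms, instead of tuples from a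
  dual basis, gives the Plucker coordinates and their linear combinations without choosing a basis.\<close>

definition plucker_coord :: "('k, 'm) ring_scheme \<Rightarrow> nat \<Rightarrow> (nat \<Rightarrow> 'v \<Rightarrow> 'k) \<Rightarrow> (nat \<Rightarrow> 'v) \<Rightarrow> 'k" where
  "plucker_coord K d \<phi> b =
    (\<Oplus>\<^bsub>K\<^esub>\<pi>\<in>{\<pi>. \<pi> permutes {..<d}}.
      (if evenperm \<pi> then \<one>\<^bsub>K\<^esub> else \<ominus>\<^bsub>K\<^esub> \<one>\<^bsub>K\<^esub>) \<otimes>\<^bsub>K\<^esub> (\<Otimes>\<^bsub>K\<^esub>r\<in>{..<d}. \<phi> r (b (\<pi> r))))"

text \<open>\<open>plucker_form K l V d e F\<close>: \<open>F\<close> is a polynomial in the Plucker coordinates of \<open>l\<close> subspaces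
  of dimensions \<open>d 1, \<dots>, d l\<close>, homogeneous of degree \<open>e i\<close> in the coordinates of the \<open>i\<close>-th one,
  viewed as a function of frames \<open>b i\<close> of these subspaces.\<close>

inductive plucker_form ::
    "('k, 'm) ring_scheme \<Rightarrow> nat \<Rightarrow> (nat \<Rightarrow> ('k, 'v) module) \<Rightarrow> (nat \<Rightarrow> nat)
      \<Rightarrow> (nat \<Rightarrow> nat) \<Rightarrow> ((nat \<Rightarrow> nat \<Rightarrow> 'v) \<Rightarrow> 'k) \<Rightarrow> bool"
  for K l V d where
  const: "c \<in> carrier K \<Longrightarrow> plucker_form K l V d (\<lambda>i. 0) (\<lambda>b. c)"
| coord: "i \<in> {1..l} \<Longrightarrow> \<phi> \<in> {..<d i} \<rightarrow> linear_forms K (V i) \<Longrightarrow>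
    plucker_form K l V d ((\<lambda>j. 0)(i := 1)) (\<lambda>b. plucker_coord K (d i) \<phi> (b i))"
| add: "plucker_form K l V d e F \<Longrightarrow> plucker_form K l V d e G \<Longrightarrow>
    plucker_form K l V d e (\<lambda>b. F b \<oplus>\<^bsub>K\<^esub> G b)"
| mult: "plucker_form K l V d e F \<Longrightarrow> plucker_form K l V d e' G \<Longrightarrow>
    plucker_form K l V d (\<lambda>i. e i + e' i) (\<lambda>b. F b \<otimes>\<^bsub>K\<^esub> G b)"

text \<open>For a subspace of dimension \<open>d i\<close>, a spanning \<open>d i\<close>-tuple is a basis.\<close>

definition frames ::
    "('k, 'm) ring_scheme \<Rightarrow> nat \<Rightarrow> (nat \<Rightarrow> ('k, 'v) module) \<Rightarrow> (nat \<Rightarrow> nat)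
      \<Rightarrow> (nat \<Rightarrow> 'v set) \<Rightarrow> (nat \<Rightarrow> nat \<Rightarrow> 'v) set" where
  "frames K l V d V' =
    {b. \<forall>i\<in>{1..l}. b i ` {..<d i} \<subseteq> V' i \<and> LinearCombinations.module.span K (V i) (b i ` {..<d i}) = V' i}"

text \<open>By homogeneity, whether \<open>F\<close> vanishes at a tuple of subspaces does not depend on the frames.\<close>

definition principal_open ::
    "('k, 'm) ring_scheme \<Rightarrow> nat \<Rightarrow> (nat \<Rightarrow> ('k, 'v) module) \<Rightarrow> (nat \<Rightarrow> nat)
      \<Rightarrow> ((nat \<Rightarrow> nat \<Rightarrow> 'v) \<Rightarrow> 'k) \<Rightarrow> (nat \<Rightarrow> 'v set) set" where
  "principal_open K l V d F =
    {V' \<in> grassmannian_product K l V d. \<exists>b\<in>frames K l V d V'. F b \<noteq> \<zero>\<^bsub>K\<^esub>}"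

definition zariski_grassmannian ::
    "('k, 'm) ring_scheme \<Rightarrow> nat \<Rightarrow> (nat \<Rightarrow> ('k, 'v) module) \<Rightarrow> (nat \<Rightarrow> nat) \<Rightarrow> (nat \<Rightarrow> 'v set) topology" where
  "zariski_grassmannian K l V d =
    topology_generated_by {principal_open K l V d F | e F. plucker_form K l V d e F}"

definition for_general_subspaces ::
    "('k, 'm) ring_scheme \<Rightarrow> nat \<Rightarrow> (nat \<Rightarrow> ('k, 'v) module) \<Rightarrow> ((nat \<Rightarrow> 'v set) \<Rightarrow> bool) \<Rightarrow> bool" where
  "for_general_subspaces K l V P \<longleftrightarrow>
    (\<forall>d. \<exists>\<Omega>. openin (zariski_grassmannian K l V d) \<Omega>
           \<and> zariski_grassmannian K l V d closure_of \<Omega> = grassmannian_product K l V d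
           \<and> (\<forall>V'\<in>\<Omega>. P V'))"


section \<open>Maximal rank properties\<close>

definition maximal_rank :: "('k, 'a) module \<Rightarrow> ('k, 'b) module \<Rightarrow> ('a \<Rightarrow> 'b) \<Rightarrow> bool" where
  "maximal_rank A B f \<longleftrightarrow> inj_on f (carrier A) \<or> f ` carrier A = carrier B"

text \<open>The restriction of \<open>T\<close> to \<open>\<Oplus>\<^sub>i (V'\<^sub>i \<otimes> W\<^sub>i)\<close> is the composition of \<open>T\<close> with
  \<open>\<Oplus>\<^sub>i (\<iota>\<^sub>i \<otimes> 1)\<close>, where \<open>\<iota>\<^sub>i : V'\<^sub>i \<rightarrow> V\<^sub>i\<close> is the inclusion.\<close>

definition restriction_max_rank ::
    "('k, 'm) ring_scheme \<Rightarrow> nat \<Rightarrow> (nat \<Rightarrow> ('k, 'v) module) \<Rightarrow> (nat \<Rightarrow> ('k, 'w) module)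
      \<Rightarrow> ('k, 'u) module \<Rightarrow> ((nat \<Rightarrow> ('v \<times> 'w \<Rightarrow> 'k) set) \<Rightarrow> 'u) \<Rightarrow> (nat \<Rightarrow> 'v set) \<Rightarrow> bool" where
  "restriction_max_rank K l V W U T V' \<longleftrightarrow>
    maximal_rank (tensor_sum K l (\<lambda>i. (V i)\<lparr>carrier := V' i\<rparr>) W) U
      (T \<circ> tensor_sum_map K l (\<lambda>i. (V i)\<lparr>carrier := V' i\<rparr>) V W (\<lambda>i v. v))"

definition projection_max_rank ::
    "('k, 'm) ring_scheme \<Rightarrow> nat \<Rightarrow> (nat \<Rightarrow> ('k, 'v) module) \<Rightarrow> (nat \<Rightarrow> ('k, 'w) module)
      \<Rightarrow> ('k, 'q) module \<Rightarrow> ('q \<Rightarrow> (nat \<Rightarrow> ('v \<times> 'w \<Rightarrow> 'k) set)) \<Rightarrow> (nat \<Rightarrow> 'v set) \<Rightarrow> bool" where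
  "projection_max_rank K l V W Q S V' \<longleftrightarrow>
    maximal_rank Q (tensor_sum K l (\<lambda>i. quotient_space (V i) (V' i)) W)
      (tensor_sum_map K l V (\<lambda>i. quotient_space (V i) (V' i)) W (\<lambda>i. quotient_proj (V i) (V' i)) \<circ> S)"

definition left_omnipresent_from ::
    "('k, 'm) ring_scheme \<Rightarrow> nat \<Rightarrow> (nat \<Rightarrow> ('k, 'v) module) \<Rightarrow> (nat \<Rightarrow> ('k, 'w) module)
      \<Rightarrow> ('k, 'u) module \<Rightarrow> ((nat \<Rightarrow> ('v \<times> 'w \<Rightarrow> 'k) set) \<Rightarrow> 'u) \<Rightarrow> bool" where
  "left_omnipresent_from K l V W U T \<longleftrightarrow>
    (\<forall>V'\<in>subspace_families K l V. restriction_max_rank K l V W U T V')"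

definition left_general_from ::
    "('k, 'm) ring_scheme \<Rightarrow> nat \<Rightarrow> (nat \<Rightarrow> ('k, 'v) module) \<Rightarrow> (nat \<Rightarrow> ('k, 'w) module)
      \<Rightarrow> ('k, 'u) module \<Rightarrow> ((nat \<Rightarrow> ('v \<times> 'w \<Rightarrow> 'k) set) \<Rightarrow> 'u) \<Rightarrow> bool" where
  "left_general_from K l V W U T \<longleftrightarrow>
    for_general_subspaces K l V (restriction_max_rank K l V W U T)"

definition left_omnipresent_to ::
    "('k, 'm) ring_scheme \<Rightarrow> nat \<Rightarrow> (nat \<Rightarrow> ('k, 'v) module) \<Rightarrow> (nat \<Rightarrow> ('k, 'w) module)
      \<Rightarrow> ('k, 'q) module \<Rightarrow> ('q \<Rightarrow> (nat \<Rightarrow> ('v \<times> 'w \<Rightarrow> 'k) set)) \<Rightarrow> bool" where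
  "left_omnipresent_to K l V W Q S \<longleftrightarrow>
    (\<forall>V'\<in>subspace_families K l V. projection_max_rank K l V W Q S V')"

definition left_general_to ::
    "('k, 'm) ring_scheme \<Rightarrow> nat \<Rightarrow> (nat \<Rightarrow> ('k, 'v) module) \<Rightarrow> (nat \<Rightarrow> ('k, 'w) module)
      \<Rightarrow> ('k, 'q) module \<Rightarrow> ('q \<Rightarrow> (nat \<Rightarrow> ('v \<times> 'w \<Rightarrow> 'k) set)) \<Rightarrow> bool" where
  "left_general_to K l V W Q S \<longleftrightarrow>
    for_general_subspaces K l V (projection_max_rank K l V W Q S)"

definition fin_dim_space :: "('k, 'm) ring_scheme \<Rightarrow> ('k, 'v) module \<Rightarrow> bool" where
  "fin_dim_space K V \<longleftrightarrow> vectorspace K V \<and> vectorspace.fin_dim K V"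

end

theory Submission
  imports Defs
begin

text \<open>Both parts are instances of one symmetric fact about two short exact sequences
  \<open>0 \<rightarrow> Q \<rightarrow> A \<rightarrow> U \<rightarrow> 0\<close> and \<open>0 \<rightarrow> A' \<rightarrow> A \<rightarrow> B \<rightarrow> 0\<close> with the same middle term: \<open>A' \<rightarrow> U\<close> is
  injective iff \<open>Q \<inter> A' = 0\<close> iff \<open>Q \<rightarrow> B\<close> is injective, and \<open>A' \<rightarrow> U\<close> is surjective iff
  \<open>Q + A' = A\<close> iff \<open>Q \<rightarrow> B\<close> is surjective. It is applied with \<open>A = \<Oplus>\<^sub>i (V\<^sub>i \<otimes> W\<^sub>i)\<close>,
  \<open>A' = \<Oplus>\<^sub>i (V'\<^sub>i \<otimes> W\<^sub>i)\<close> and \<open>B = \<Oplus>\<^sub>i ((V\<^sub>i/V'\<^sub>i) \<otimes> W\<^sub>i)\<close>, so that the two maximal rank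
  conditions agree for each single choice of the \<open>V'\<^sub>i\<close>. Exactness of
  \<open>V' \<otimes> W \<rightarrow> V \<otimes> W \<rightarrow> (V/V') \<otimes> W\<close> follows by functoriality of the tensor product, because
  \<open>V' \<rightarrow> V \<rightarrow> V/V'\<close> splits.\<close>

section \<open>Linear maps and submodules as additive subgroups\<close>

lemma (in abelian_group) minus_zero_right:
  "x \<in> carrier G \<Longrightarrow> x \<ominus> \<zero> = x"
  using minus_equality[of \<zero> \<zero>] by (simp add: a_minus_def)

lemma mod_homI:
  assumes "Module.module R M" "Module.module R N"
    and "\<And>x. x \<in> carrier M \<Longrightarrow> f x \<in> carrier N"
    and "\<And>x y. x \<in> carrier M \<Longrightarrow> y \<in> carrier M \<Longrightarrow> f (x \<oplus>\<^bsub>M\<^esub> y) = f x \<oplus>\<^bsub>N\<^esub> f y"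
    and "\<And>c x. c \<in> carrier R \<Longrightarrow> x \<in> carrier M \<Longrightarrow> f (c \<odot>\<^bsub>M\<^esub> x) = c \<odot>\<^bsub>N\<^esub> f x"
  shows "mod_hom R M N f"
  using assms by (auto simp add: mod_hom_def mod_hom_axioms_def LinearCombinations.module_hom_def)

text \<open>Closure under negation comes from scaling by -1, because
  \<open>LinearCombinations.submodule\<close> only asks for zero, sums and scalar multiples. The
  second conclusion gives access to the theory of cosets on which \<open>quotient_space\<close>
  rests.\<close>

lemma submodule_additive_subgroup:
  assumes "LinearCombinations.submodule R N M"
  shows "additive_subgroup N M" and "abelian_subgroup N M"
proof -
  interpret N: LinearCombinations.submodule R N M by (rule assms)
  interpret Module.module R M by (rule N.module)
  have "\<ominus>\<^bsub>M\<^esub> x \<in> N" if "x \<in> N" for x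
    using that N.subset N.smult_closed[of "\<ominus>\<^bsub>R\<^esub> \<one>\<^bsub>R\<^esub>" x] smult_minus_1[of x]
    by (metis R.add.inv_closed R.one_closed subsetD)
  then show "additive_subgroup N M"
    using N.subset by unfold_locales (auto simp flip: a_inv_def)
  then show "abelian_subgroup N M"
    by (rule abelian_subgroupI3) (rule M.abelian_group_axioms)
qed

lemma submodule_minus_closed:
  assumes "LinearCombinations.submodule R N M" "x \<in> N" "y \<in> N"
  shows "x \<ominus>\<^bsub>M\<^esub> y \<in> N"
  using submodule_additive_subgroup(1)[OF assms(1)] assms(2,3)
  by (simp add: a_minus_def additive_subgroup.a_closed additive_subgroup.a_inv_closed
      LinearCombinations.submodule.module[OF assms(1)] module.axioms(2))


section \<open>Quotient modules\<close>

context
  fixes R :: "('k, 'm) ring_scheme" and M :: "('k, 'v) module" and N :: "'v set"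
  assumes N: "LinearCombinations.submodule R N M"
begin

interpretation N: LinearCombinations.submodule R N M by (rule N)
interpretation Module.module R M by (rule N.module)
interpretation N: abelian_subgroup N M by (rule submodule_additive_subgroup(2)[OF N])

lemma quotient_proj_eq_iff:
  assumes "x \<in> carrier M" "y \<in> carrier M"
  shows "quotient_proj M N x = quotient_proj M N y \<longleftrightarrow> x \<ominus>\<^bsub>M\<^esub> y \<in> N"
proof -
  have "quotient_proj M N x = quotient_proj M N y \<longleftrightarrow> x \<in> quotient_proj M N y"
    unfolding quotient_proj_def
    using assms N.a_rcos_self N.a_repr_independence' N.a_subset by metis
  also have "\<dots> \<longleftrightarrow> x \<ominus>\<^bsub>M\<^esub> y \<in> N"
    unfolding quotient_proj_def using assms N.a_rcos_module by (simp add: a_minus_def)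
  finally show ?thesis .
qed

lemma carrier_quotient_space:
  "carrier (quotient_space M N) = quotient_proj M N ` carrier M"
  by (auto simp: quotient_space_def quotient_proj_def A_RCOSETS_def')

lemma quotient_proj_add:
  assumes "x \<in> carrier M" "y \<in> carrier M"
  shows "quotient_proj M N (x \<oplus>\<^bsub>M\<^esub> y)
    = quotient_proj M N x \<oplus>\<^bsub>quotient_space M N\<^esub> quotient_proj M N y"
  using N.a_rcos_sum[OF assms] by (simp add: quotient_space_def quotient_proj_def)

lemma quotient_proj_zero: "quotient_proj M N \<zero>\<^bsub>M\<^esub> = \<zero>\<^bsub>quotient_space M N\<^esub>"
  using N.subset by (simp add: quotient_space_def quotient_proj_def)

text \<open>The set of all \<open>c\<close> times elements of a coset need not be a whole coset; for
  \<open>c\<close> zero it is just the zero element. Adding \<open>N\<close>, as the definition of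
  \<open>quotient_space\<close> does, fills it up to the coset of \<open>c\<close> times
  \<open>x\<close>.\<close>

lemma quotient_proj_smult:
  assumes c: "c \<in> carrier R" and x: "x \<in> carrier M"
  shows "quotient_proj M N (c \<odot>\<^bsub>M\<^esub> x) = c \<odot>\<^bsub>quotient_space M N\<^esub> quotient_proj M N x"
proof -
  have eq: "h \<oplus>\<^bsub>M\<^esub> c \<odot>\<^bsub>M\<^esub> (h' \<oplus>\<^bsub>M\<^esub> x) = (h \<oplus>\<^bsub>M\<^esub> c \<odot>\<^bsub>M\<^esub> h') \<oplus>\<^bsub>M\<^esub> c \<odot>\<^bsub>M\<^esub> x"
    if "h \<in> N" "h' \<in> N" for h h'
    using that N.subset c x by (simp add: smult_r_distr M.add.m_assoc subset_iff)
  \<comment> \<open>The right-hand set is N + c(N + x) written elementwise. One inclusion takes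
    \<open>h'\<close> to be zero; the other absorbs \<open>h\<close> plus \<open>c\<close> times
    \<open>h'\<close> into \<open>N\<close>.\<close>
  have "{h \<oplus>\<^bsub>M\<^esub> c \<odot>\<^bsub>M\<^esub> x |h. h \<in> N} = {h \<oplus>\<^bsub>M\<^esub> c \<odot>\<^bsub>M\<^esub> (h' \<oplus>\<^bsub>M\<^esub> x) |h h'. h \<in> N \<and> h' \<in> N}"
  proof (intro equalityI subsetI)
    fix z assume "z \<in> {h \<oplus>\<^bsub>M\<^esub> c \<odot>\<^bsub>M\<^esub> x |h. h \<in> N}"
    then obtain h where "h \<in> N" "z = h \<oplus>\<^bsub>M\<^esub> c \<odot>\<^bsub>M\<^esub> (\<zero>\<^bsub>M\<^esub> \<oplus>\<^bsub>M\<^esub> x)"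
      using x by auto
    then show "z \<in> {h \<oplus>\<^bsub>M\<^esub> c \<odot>\<^bsub>M\<^esub> (h' \<oplus>\<^bsub>M\<^esub> x) |h h'. h \<in> N \<and> h' \<in> N}"
      using N.zero_closed by blast
  qed (use c eq in blast)
  moreover have "quotient_proj M N (c \<odot>\<^bsub>M\<^esub> x) = {h \<oplus>\<^bsub>M\<^esub> c \<odot>\<^bsub>M\<^esub> x |h. h \<in> N}"
    unfolding quotient_proj_def a_r_coset_def' by blast
  moreover have "c \<odot>\<^bsub>quotient_space M N\<^esub> quotient_proj M N x
      = {h \<oplus>\<^bsub>M\<^esub> c \<odot>\<^bsub>M\<^esub> (h' \<oplus>\<^bsub>M\<^esub> x) |h h'. h \<in> N \<and> h' \<in> N}"
    unfolding quotient_space_def quotient_proj_def a_r_coset_def' set_add_def' module.simps by blast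
  ultimately show ?thesis
    by simp
qed

text \<open>Every class is the image of an element of \<open>M\<close> and the projection respects
  all operations, so each module law is inherited from \<open>M\<close>.\<close>

lemma module_quotient_space: "Module.module R (quotient_space M N)"
proof (rule module_criteria)
  show "\<forall>v\<in>carrier (quotient_space M N). \<exists>w\<in>carrier (quotient_space M N).
      v \<oplus>\<^bsub>quotient_space M N\<^esub> w = \<zero>\<^bsub>quotient_space M N\<^esub>"
  proof
    fix v assume "v \<in> carrier (quotient_space M N)"
    then obtain x where x: "x \<in> carrier M" "v = quotient_proj M N x"
      by (auto simp: carrier_quotient_space)
    then have "v \<oplus>\<^bsub>quotient_space M N\<^esub> quotient_proj M N (\<ominus>\<^bsub>M\<^esub> x) = \<zero>\<^bsub>quotient_space M N\<^esub>"
      by (simp add: M.r_neg quotient_proj_zero flip: quotient_proj_add)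
    with x show "\<exists>w\<in>carrier (quotient_space M N).
        v \<oplus>\<^bsub>quotient_space M N\<^esub> w = \<zero>\<^bsub>quotient_space M N\<^esub>"
      by (auto simp: carrier_quotient_space)
  qed
qed (auto simp: carrier_quotient_space R.is_cring M.a_ac smult_assoc1 smult_l_distr smult_r_distr
      simp flip: quotient_proj_add quotient_proj_smult quotient_proj_zero)

lemma mod_hom_quotient_proj: "mod_hom R M (quotient_space M N) (quotient_proj M N)"
  by (intro mod_homI module_quotient_space module_axioms)
    (auto simp: carrier_quotient_space quotient_proj_add quotient_proj_smult)

lemma quotient_proj_eq_zero_iff:
  assumes "x \<in> carrier M"
  shows "quotient_proj M N x = \<zero>\<^bsub>quotient_space M N\<^esub> \<longleftrightarrow> x \<in> N"
  using assms N.a_rcos_const N.a_rcos_self by (auto simp: quotient_space_def quotient_proj_def)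

text \<open>Universal property of the quotient, used to define linear maps out of tensor
  products.\<close>

lemma quotient_lift:
  assumes h: "mod_hom R M P h" and 0: "\<And>x. x \<in> N \<Longrightarrow> h x = \<zero>\<^bsub>P\<^esub>"
  obtains g where "mod_hom R (quotient_space M N) P g"
    and "\<And>x. x \<in> carrier M \<Longrightarrow> g (quotient_proj M N x) = h x"
proof -
  interpret h: mod_hom R M P h by (rule h)
  \<comment> \<open>\<open>g\<close> evaluates \<open>h\<close> at a chosen representative. The
    choice is harmless: two representatives of a class differ by an element of \<open>N\<close>,
    where \<open>h\<close> vanishes.\<close>
  define g where "g A = h (inv_into (carrier M) (quotient_proj M N) A)" for A
  have g: "g (quotient_proj M N x) = h x" if x: "x \<in> carrier M" for x
  proof -
    let ?y = "inv_into (carrier M) (quotient_proj M N) (quotient_proj M N x)"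
    have y: "?y \<in> carrier M" "quotient_proj M N ?y = quotient_proj M N x"
      using x inv_into_into[OF imageI] f_inv_into_f[OF imageI] by metis+
    then have "h (?y \<ominus>\<^bsub>M\<^esub> x) = \<zero>\<^bsub>P\<^esub>"
      using x by (intro 0) (simp add: quotient_proj_eq_iff)
    then show ?thesis
      using x y by (simp add: g_def)
  qed
  have "mod_hom R (quotient_space M N) P g"
    by (intro mod_homI module_quotient_space h.N.module_axioms)
      (auto simp: carrier_quotient_space g simp flip: quotient_proj_add quotient_proj_smult)
  from this g show thesis by (rule that)
qed

end


section \<open>Free modules\<close>

context cring
begin

lemma carrier_free_space:
  "carrier (free_space R B) = {f \<in> B \<rightarrow>\<^sub>E carrier R. finite {x \<in> B. f x \<noteq> \<zero>}}"
  by (simp add: free_space_def)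

lemma free_space_simps:
  "\<zero>\<^bsub>free_space R B\<^esub> = (\<lambda>x\<in>B. \<zero>)"
  "f \<oplus>\<^bsub>free_space R B\<^esub> g = (\<lambda>x\<in>B. f x \<oplus> g x)"
  "c \<odot>\<^bsub>free_space R B\<^esub> f = (\<lambda>x\<in>B. c \<otimes> f x)"
  by (simp_all add: free_space_def func_space_def)

lemma finite_support_add:
  assumes "finite {x \<in> B. f x \<noteq> \<zero>}" "finite {x \<in> B. g x \<noteq> \<zero>}"
  shows "finite {x \<in> B. f x \<oplus> g x \<noteq> \<zero>}"
  by (rule finite_subset[OF _ finite_UnI[OF assms]]) auto

lemma finite_support_mult:
  assumes "finite {x \<in> B. f x \<noteq> \<zero>}" "c \<in> carrier R"
  shows "finite {x \<in> B. c \<otimes> f x \<noteq> \<zero>}"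
  using assms(2) by (auto intro: finite_subset[OF _ assms(1)])

text \<open>The functions of finite support form a submodule of the module
  \<open>func_space B\<close> of all functions on \<open>B\<close>.\<close>

lemma module_free_space: "Module.module R (free_space R B)"
proof -
  have "LinearCombinations.submodule R {f \<in> B \<rightarrow>\<^sub>E carrier R. finite {x \<in> B. f x \<noteq> \<zero>}} (func_space B)"
  proof (intro LinearCombinations.submodule.intro func_space_is_module)
  qed (auto simp: func_space_def restrict_PiE_iff restrict_def[of _ B] cong: conj_cong
      intro!: a_closed m_closed intro: PiE_mem finite_support_add finite_support_mult[simplified])
  then show ?thesis
    unfolding free_space_def
    by (rule module.submodule_is_module[OF func_space_is_module])
qed

lemma free_space_apply_closed:
  "f \<in> carrier (free_space R B) \<Longrightarrow> x \<in> B \<Longrightarrow> f x \<in> carrier R"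
  by (auto simp: carrier_free_space)

lemma free_space_apply_undefined:
  "f \<in> carrier (free_space R B) \<Longrightarrow> x \<notin> B \<Longrightarrow> f x = undefined"
  by (auto simp: carrier_free_space PiE_arb[of f B "\<lambda>_. carrier R" x])

lemma free_gen_support: "{y \<in> B. free_gen R B x y \<noteq> \<zero>} \<subseteq> {x}"
  by (auto simp: free_gen_def)

lemma free_gen_closed: "free_gen R B x \<in> carrier (free_space R B)"
  using finite_subset[OF free_gen_support] by (auto simp: carrier_free_space free_gen_def)

text \<open>A function of finite support is a finite sum of multiples of generators. The induction
  runs over a finite set \<open>A\<close> that contains the support, for all such functions at once,
  so that removing a point from \<open>A\<close> amounts to deleting one value.\<close>

lemma free_space_induct:
  assumes f: "f \<in> carrier (free_space R B)"
    and zero: "P \<zero>\<^bsub>free_space R B\<^esub>"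
    and add: "\<And>x c f. x \<in> B \<Longrightarrow> c \<in> carrier R \<Longrightarrow> f \<in> carrier (free_space R B) \<Longrightarrow> P f \<Longrightarrow>
      P (c \<odot>\<^bsub>free_space R B\<^esub> free_gen R B x \<oplus>\<^bsub>free_space R B\<^esub> f)"
  shows "P f"
proof -
  have *: "P f" if "finite A" "A \<subseteq> B" "f \<in> carrier (free_space R B)" "{x \<in> B. f x \<noteq> \<zero>} \<subseteq> A" for A f
    using that
  proof (induction A arbitrary: f rule: finite_subset_induct')
    case empty
    then have "f x = (\<lambda>x\<in>B. \<zero>) x" for x
      using free_space_apply_undefined[of f B x] by (cases "x \<in> B") auto
    then have "f = \<zero>\<^bsub>free_space R B\<^esub>"
      by (simp add: free_space_simps fun_eq_iff)
    then show ?case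
      using zero by simp
  next
    case (insert a A)
    \<comment> \<open>\<open>?g\<close> is \<open>f\<close> with its value at \<open>a\<close>
      deleted, so \<open>f\<close> is \<open>?g\<close> plus \<open>f a\<close> times the generator
      at \<open>a\<close>.\<close>
    let ?g = "\<lambda>x\<in>B. if x = a then \<zero> else f x"
    note fB = free_space_apply_closed[OF insert.prems(1)]
    have sub: "{x \<in> B. ?g x \<noteq> \<zero>} \<subseteq> A"
      using insert.prems(2) by (auto split: if_splits)
    have g: "?g \<in> carrier (free_space R B)"
      using fB finite_subset[OF sub insert.hyps(1)] by (auto simp: carrier_free_space)
    have "f x = (\<lambda>x\<in>B. (\<lambda>x\<in>B. f a \<otimes> free_gen R B a x) x \<oplus> ?g x) x" for x
      using insert.hyps(2) fB free_space_apply_undefined[OF insert.prems(1), of x]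
      by (cases "x \<in> B") (auto simp: free_gen_def)
    then have eq: "f = f a \<odot>\<^bsub>free_space R B\<^esub> free_gen R B a \<oplus>\<^bsub>free_space R B\<^esub> ?g"
      by (simp add: free_space_simps fun_eq_iff)
    show ?case
      using add[OF insert.hyps(2) fB[OF insert.hyps(2)] g insert.IH[OF g sub]]
      unfolding eq[symmetric] .
  qed
  show ?thesis
    by (rule *[OF _ _ f subset_refl]) (use f in \<open>auto simp: carrier_free_space\<close>)
qed

text \<open>Universal property of the free module: \<open>h\<close> is the linear combination of the
  values of \<open>g\<close> with the coefficients \<open>f x\<close>.\<close>

lemma free_lift:
  assumes "Module.module R M" and g: "g \<in> B \<rightarrow> carrier M"
  obtains h where "mod_hom R (free_space R B) M h"
    and "\<And>x. x \<in> B \<Longrightarrow> h (free_gen R B x) = g x"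
proof -
  interpret M: Module.module R M by (rule assms(1))
  interpret F: Module.module R "free_space R B" by (rule module_free_space)
  define h where "h f = (\<Oplus>\<^bsub>M\<^esub>x\<in>{x \<in> B. f x \<noteq> \<zero>}. f x \<odot>\<^bsub>M\<^esub> g x)" for f
  \<comment> \<open>The support varies with \<open>f\<close>. Allowing any finite superset as the
    range of summation, where the additional terms are zero, makes \<open>h\<close> comparable on
    \<open>f\<close>, \<open>f'\<close> and their sum.\<close>
  have h_eq: "h f = (\<Oplus>\<^bsub>M\<^esub>x\<in>A. f x \<odot>\<^bsub>M\<^esub> g x)"
    if "f \<in> carrier (free_space R B)" "finite A" "{x \<in> B. f x \<noteq> \<zero>} \<subseteq> A" "A \<subseteq> B" for f A
    unfolding h_def using that g
    by (intro M.add.finprod_mono_neutral_cong_left)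
      (auto simp: Pi_iff free_space_apply_closed subset_iff)
  have "h f \<in> carrier M" if "f \<in> carrier (free_space R B)" for f
    using that g unfolding h_def
    by (intro M.finsum_closed) (auto simp: Pi_iff free_space_apply_closed)
  moreover have "h (f \<oplus>\<^bsub>free_space R B\<^esub> f') = h f \<oplus>\<^bsub>M\<^esub> h f'"
    if f: "f \<in> carrier (free_space R B)" "f' \<in> carrier (free_space R B)" for f f'
  proof -
    let ?A = "{x \<in> B. f x \<noteq> \<zero>} \<union> {x \<in> B. f' x \<noteq> \<zero>}"
    have fin: "finite ?A"
      using f by (simp add: carrier_free_space)
    have "h (f \<oplus>\<^bsub>free_space R B\<^esub> f')
        = (\<Oplus>\<^bsub>M\<^esub>x\<in>?A. (f \<oplus>\<^bsub>free_space R B\<^esub> f') x \<odot>\<^bsub>M\<^esub> g x)"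
      using f fin F.M.a_closed[OF f] by (intro h_eq) (auto simp: free_space_simps)
    also have "\<dots> = (\<Oplus>\<^bsub>M\<^esub>x\<in>?A. f x \<odot>\<^bsub>M\<^esub> g x \<oplus>\<^bsub>M\<^esub> f' x \<odot>\<^bsub>M\<^esub> g x)"
      using f g
      by (intro M.finsum_cong') (auto simp: free_space_simps Pi_iff free_space_apply_closed M.smult_l_distr)
    also have "\<dots> = h f \<oplus>\<^bsub>M\<^esub> h f'"
      using f g fin h_eq[of f ?A] h_eq[of f' ?A]
      by (subst M.finsum_addf) (auto simp: Pi_iff free_space_apply_closed)
    finally show ?thesis .
  qed
  moreover have "h (c \<odot>\<^bsub>free_space R B\<^esub> f) = c \<odot>\<^bsub>M\<^esub> h f"
    if c: "c \<in> carrier R" and f: "f \<in> carrier (free_space R B)" for c f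
  proof -
    let ?A = "{x \<in> B. f x \<noteq> \<zero>}"
    have fin: "finite ?A"
      using f by (simp add: carrier_free_space)
    have "h (c \<odot>\<^bsub>free_space R B\<^esub> f) = (\<Oplus>\<^bsub>M\<^esub>x\<in>?A. (c \<odot>\<^bsub>free_space R B\<^esub> f) x \<odot>\<^bsub>M\<^esub> g x)"
      using c f fin F.smult_closed[OF c f] by (intro h_eq) (auto simp: free_space_simps)
    also have "\<dots> = (\<Oplus>\<^bsub>M\<^esub>x\<in>?A. c \<odot>\<^bsub>M\<^esub> (f x \<odot>\<^bsub>M\<^esub> g x))"
      using c f g
      by (intro M.finsum_cong') (auto simp: free_space_simps Pi_iff free_space_apply_closed M.smult_assoc1)
    also have "\<dots> = c \<odot>\<^bsub>M\<^esub> h f"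
      using c f g fin unfolding h_def
      by (subst M.finsum_smult_ldistr) (auto simp: Pi_iff free_space_apply_closed)
    finally show ?thesis .
  qed
  ultimately have "mod_hom R (free_space R B) M h"
    by (intro mod_homI F.module_axioms M.module_axioms)
  moreover have "h (free_gen R B x) = g x" if x: "x \<in> B" for x
  proof -
    have "h (free_gen R B x) = free_gen R B x x \<odot>\<^bsub>M\<^esub> g x"
      using x g h_eq[OF free_gen_closed _ free_gen_support, of x]
        free_space_apply_closed[OF free_gen_closed x]
      by (auto simp: Pi_iff)
    then show ?thesis
      using x funcset_mem[OF g x] by (simp add: free_gen_def)
  qed
  ultimately show thesis
    by (rule that)
qed

end


section \<open>Tensor products\<close>

locale module_pair = V: Module.module R V + W: Module.module R W
  for R :: "('k, 'm) ring_scheme" and V :: "('k, 'v) module" and W :: "('k, 'w) module"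
begin

abbreviation "FVW \<equiv> free_space R (carrier V \<times> carrier W)"
abbreviation "gen v w \<equiv> free_gen R (carrier V \<times> carrier W) (v, w)"
abbreviation "pure \<equiv> pure_tensor R V W"
abbreviation "VW \<equiv> tensor_space R V W"

sublocale F: Module.module R "FVW"
  by (rule V.module_free_space)

lemma gen_closed: "gen v w \<in> carrier FVW"
  by (rule V.free_gen_closed)

lemma bilinear_relations_closed: "bilinear_relations R V W \<subseteq> carrier FVW"
  unfolding bilinear_relations_def Let_def
  by (auto intro!: F.M.minus_closed F.M.a_closed F.smult_closed gen_closed)

lemma submodule_tensor_null: "LinearCombinations.submodule R (tensor_null R V W) FVW"
  unfolding tensor_null_def by (rule F.span_is_submodule[OF bilinear_relations_closed])

lemma bilinear_relations_null: "bilinear_relations R V W \<subseteq> tensor_null R V W"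
  unfolding tensor_null_def by (rule F.in_own_span[OF bilinear_relations_closed])

lemma module_tensor_space: "Module.module R VW"
  unfolding tensor_space_def by (rule module_quotient_space[OF submodule_tensor_null])

sublocale T: Module.module R VW
  by (rule module_tensor_space)

lemma pure_closed: "pure v w \<in> carrier VW"
  by (simp add: pure_tensor_def tensor_space_def carrier_quotient_space[OF submodule_tensor_null] gen_closed)

text \<open>Each bilinearity relation is a difference of two elements of the free module, so it
  identifies their classes. The four rules of bilinearity for \<open>pure\<close> below are
  instances.\<close>

lemma pure_eqI:
  assumes "f \<ominus>\<^bsub>FVW\<^esub> g \<in> bilinear_relations R V W" "f \<in> carrier FVW" "g \<in> carrier FVW"
  shows "quotient_proj FVW (tensor_null R V W) f = quotient_proj FVW (tensor_null R V W) g"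
  using assms bilinear_relations_null by (subst quotient_proj_eq_iff[OF submodule_tensor_null]) auto

lemma pure_add_left:
  assumes "v \<in> carrier V" "v' \<in> carrier V" "w \<in> carrier W"
  shows "pure (v \<oplus>\<^bsub>V\<^esub> v') w = pure v w \<oplus>\<^bsub>VW\<^esub> pure v' w"
  unfolding pure_tensor_def tensor_space_def
    quotient_proj_add[OF submodule_tensor_null gen_closed gen_closed, symmetric]
  by (rule pure_eqI) (use assms in \<open>auto simp: bilinear_relations_def Let_def gen_closed\<close>)

lemma pure_add_right:
  assumes "v \<in> carrier V" "w \<in> carrier W" "w' \<in> carrier W"
  shows "pure v (w \<oplus>\<^bsub>W\<^esub> w') = pure v w \<oplus>\<^bsub>VW\<^esub> pure v w'"
  unfolding pure_tensor_def tensor_space_def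
    quotient_proj_add[OF submodule_tensor_null gen_closed gen_closed, symmetric]
  by (rule pure_eqI) (use assms in \<open>auto simp: bilinear_relations_def Let_def gen_closed\<close>)

lemma pure_smult_left:
  assumes "c \<in> carrier R" "v \<in> carrier V" "w \<in> carrier W"
  shows "pure (c \<odot>\<^bsub>V\<^esub> v) w = c \<odot>\<^bsub>VW\<^esub> pure v w"
  unfolding pure_tensor_def tensor_space_def
    quotient_proj_smult[OF submodule_tensor_null assms(1) gen_closed, symmetric]
  by (rule pure_eqI) (use assms in \<open>auto simp: bilinear_relations_def Let_def gen_closed\<close>)

lemma pure_smult_right:
  assumes "c \<in> carrier R" "v \<in> carrier V" "w \<in> carrier W"
  shows "pure v (c \<odot>\<^bsub>W\<^esub> w) = c \<odot>\<^bsub>VW\<^esub> pure v w"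
  unfolding pure_tensor_def tensor_space_def
    quotient_proj_smult[OF submodule_tensor_null assms(1) gen_closed, symmetric]
  by (rule pure_eqI) (use assms in \<open>auto simp: bilinear_relations_def Let_def gen_closed\<close>)

text \<open>Zero is the zero multiple of itself, and the scalar can be moved out of the
  tensor.\<close>

lemma pure_zero_left:
  assumes "w \<in> carrier W"
  shows "pure \<zero>\<^bsub>V\<^esub> w = \<zero>\<^bsub>VW\<^esub>"
  using pure_smult_left[of "\<zero>\<^bsub>R\<^esub>" "\<zero>\<^bsub>V\<^esub>" w] assms pure_closed by simp

text \<open>Pure tensors generate additively: a multiple of a pure tensor is again pure, since the
  scalar moves into the left factor, and the zero tensor is itself pure. Hence no case for scalars
  or zero arises, and linear maps can be compared on pure tensors alone.\<close>

lemma tensor_induct [consumes 1, case_names pure add]: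
  assumes x: "x \<in> carrier VW"
    and pure: "\<And>v w. v \<in> carrier V \<Longrightarrow> w \<in> carrier W \<Longrightarrow> P (pure v w)"
    and add: "\<And>x y. x \<in> carrier VW \<Longrightarrow> y \<in> carrier VW \<Longrightarrow> P x \<Longrightarrow> P y \<Longrightarrow> P (x \<oplus>\<^bsub>VW\<^esub> y)"
  shows "P x"
proof -
  let ?q = "quotient_proj FVW (tensor_null R V W)"
  have VW: "VW = quotient_space FVW (tensor_null R V W)"
    by (simp add: tensor_space_def)
  have q: "?q f \<in> carrier VW" if "f \<in> carrier FVW" for f
    using that by (simp add: VW carrier_quotient_space[OF submodule_tensor_null])
  obtain f where f: "f \<in> carrier FVW" "x = ?q f"
    using x by (auto simp: VW carrier_quotient_space[OF submodule_tensor_null])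
  from f(1) have "P (?q f)"
  proof (rule V.free_space_induct)
    have "?q \<zero>\<^bsub>FVW\<^esub> = pure \<zero>\<^bsub>V\<^esub> \<zero>\<^bsub>W\<^esub>"
      by (simp add: quotient_proj_zero[OF submodule_tensor_null] pure_zero_left flip: VW)
    then show "P (?q \<zero>\<^bsub>FVW\<^esub>)"
      using pure by simp
  next
    fix x c f
    assume x: "x \<in> carrier V \<times> carrier W" and c: "c \<in> carrier R" and f: "f \<in> carrier FVW" and P: "P (?q f)"
    obtain v w where vw: "x = (v, w)" "v \<in> carrier V" "w \<in> carrier W"
      using x by auto
    have "?q (c \<odot>\<^bsub>FVW\<^esub> gen v w \<oplus>\<^bsub>FVW\<^esub> f) = pure (c \<odot>\<^bsub>V\<^esub> v) w \<oplus>\<^bsub>VW\<^esub> ?q f"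
      unfolding pure_smult_left[OF c vw(2,3)] using c f gen_closed
      by (simp add: quotient_proj_add[OF submodule_tensor_null] quotient_proj_smult[OF submodule_tensor_null]
          pure_tensor_def VW)
    moreover have "P (pure (c \<odot>\<^bsub>V\<^esub> v) w \<oplus>\<^bsub>VW\<^esub> ?q f)"
      using c f vw P pure_closed q by (intro add pure) auto
    ultimately show "P (?q (c \<odot>\<^bsub>FVW\<^esub> free_gen R (carrier V \<times> carrier W) x \<oplus>\<^bsub>FVW\<^esub> f))"
      by (simp add: vw(1))
  qed
  then show ?thesis
    by (simp add: f(2))
qed

text \<open>Universal property of the tensor product: the bilinear map \<open>b\<close> is extended
  linearly to the free module on pairs and then factored through the quotient.\<close>

lemma tensor_lift:
  assumes "Module.module R M"
    and closed: "\<And>v w. v \<in> carrier V \<Longrightarrow> w \<in> carrier W \<Longrightarrow> b v w \<in> carrier M"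
    and add_left: "\<And>v v' w. v \<in> carrier V \<Longrightarrow> v' \<in> carrier V \<Longrightarrow> w \<in> carrier W \<Longrightarrow>
      b (v \<oplus>\<^bsub>V\<^esub> v') w = b v w \<oplus>\<^bsub>M\<^esub> b v' w"
    and add_right: "\<And>v w w'. v \<in> carrier V \<Longrightarrow> w \<in> carrier W \<Longrightarrow> w' \<in> carrier W \<Longrightarrow>
      b v (w \<oplus>\<^bsub>W\<^esub> w') = b v w \<oplus>\<^bsub>M\<^esub> b v w'"
    and smult_left: "\<And>c v w. c \<in> carrier R \<Longrightarrow> v \<in> carrier V \<Longrightarrow> w \<in> carrier W \<Longrightarrow>
      b (c \<odot>\<^bsub>V\<^esub> v) w = c \<odot>\<^bsub>M\<^esub> b v w"
    and smult_right: "\<And>c v w. c \<in> carrier R \<Longrightarrow> v \<in> carrier V \<Longrightarrow> w \<in> carrier W \<Longrightarrow>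
      b v (c \<odot>\<^bsub>W\<^esub> w) = c \<odot>\<^bsub>M\<^esub> b v w"
  obtains h where "mod_hom R VW M h"
    and "\<And>v w. v \<in> carrier V \<Longrightarrow> w \<in> carrier W \<Longrightarrow> h (pure v w) = b v w"
proof -
  interpret M: Module.module R M by (rule assms(1))
  obtain k where "mod_hom R FVW M k"
    and k_gen: "\<And>x. x \<in> carrier V \<times> carrier W \<Longrightarrow> k (free_gen R (carrier V \<times> carrier W) x) = (\<lambda>(v, w). b v w) x"
    by (rule V.free_lift[OF M.module_axioms, of "\<lambda>(v, w). b v w" "carrier V \<times> carrier W"])
      (use closed in auto)
  interpret k: mod_hom R FVW M k by fact
  \<comment> \<open>Bilinearity of \<open>b\<close> says exactly that \<open>k\<close> kills the
    generating relations. The kernel is a submodule, so it contains their span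
    \<open>tensor_null\<close> as well.\<close>
  have "bilinear_relations R V W \<subseteq> k.ker"
    unfolding bilinear_relations_def Let_def k.ker_def
    by (auto simp: k_gen gen_closed closed add_left add_right smult_left smult_right)
  then have "tensor_null R V W \<subseteq> k.ker"
    unfolding tensor_null_def by (rule F.span_is_subset[OF _ k.ker_is_submodule])
  then obtain h where hom: "mod_hom R VW M h" and h: "\<And>f. f \<in> carrier FVW \<Longrightarrow>
      h (quotient_proj FVW (tensor_null R V W) f) = k f"
    using quotient_lift[OF submodule_tensor_null k.mod_hom_axioms] k.f_ker
    unfolding tensor_space_def by blast
  have "h (pure v w) = b v w" if "v \<in> carrier V" "w \<in> carrier W" for v w
    using that by (simp add: pure_tensor_def h gen_closed k_gen)
  with hom show thesis
    by (rule that)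
qed

end

section \<open>Functoriality of the tensor product in its left factor\<close>

context
  fixes R :: "('k, 'm) ring_scheme" and V :: "('k, 'v) module" and V' :: "('k, 'v2) module"
    and W :: "('k, 'w) module" and f :: "'v \<Rightarrow> 'v2"
  assumes f: "mod_hom R V V' f" and W: "Module.module R W"
begin

text \<open>Justifies the definite description in \<open>tensor_map\<close>. Existence is
  \<open>tensor_lift\<close> applied to the bilinear map that sends \<open>v\<close> and
  \<open>w\<close> to the pure tensor of \<open>f v\<close> and \<open>w\<close>; uniqueness holds
  because pure tensors generate.\<close>

lemma tensor_map_unique:
  "\<exists>!h. h \<in> LinearCombinations.module_hom R (tensor_space R V W) (tensor_space R V' W)
          \<inter> extensional (carrier (tensor_space R V W))
        \<and> (\<forall>v\<in>carrier V. \<forall>w\<in>carrier W. h (pure_tensor R V W v w) = pure_tensor R V' W (f v) w)"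
  (is "\<exists>!h. ?P h")
proof -
  interpret f: mod_hom R V V' f by (rule f)
  interpret VW: module_pair R V W
    by (intro module_pair.intro f.M.module_axioms W)
  interpret V'W: module_pair R V' W
    by (intro module_pair.intro f.N.module_axioms W)
  obtain h where h: "mod_hom R VW.VW V'W.VW h"
    and h_pure: "\<And>v w. v \<in> carrier V \<Longrightarrow> w \<in> carrier W \<Longrightarrow> h (VW.pure v w) = V'W.pure (f v) w"
    by (rule VW.tensor_lift[OF V'W.module_tensor_space, of "\<lambda>v w. V'W.pure (f v) w"])
      (auto simp: V'W.pure_closed V'W.pure_add_left V'W.pure_add_right V'W.pure_smult_left V'W.pure_smult_right)
  interpret h: mod_hom R VW.VW V'W.VW h by (rule h)
  \<comment> \<open>Restricting to the carrier makes \<open>h\<close> extensional without changing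
    its values there.\<close>
  have "?P (restrict h (carrier VW.VW))"
    by (auto simp: LinearCombinations.module_hom_def h_pure VW.pure_closed)
  moreover have "g = g'" if g: "?P g" "?P g'" for g g'
  proof (rule extensionalityI)
    fix x assume "x \<in> carrier VW.VW"
    then show "g x = g' x"
      by (induction rule: VW.tensor_induct) (use g in \<open>auto simp: LinearCombinations.module_hom_def\<close>)
  qed (use g in auto)
  ultimately show ?thesis
    by blast
qed

lemma mod_hom_tensor_map:
  "mod_hom R (tensor_space R V W) (tensor_space R V' W) (tensor_map R V V' W f)"
proof -
  interpret f: mod_hom R V V' f by (rule f)
  show ?thesis
    using theI'[OF tensor_map_unique, folded tensor_map_def] f.M.module_axioms f.N.module_axioms W
    by (auto simp: mod_hom_def mod_hom_axioms_def intro!: module_pair.module_tensor_space module_pair.intro)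
qed

lemma tensor_map_pure:
  "v \<in> carrier V \<Longrightarrow> w \<in> carrier W \<Longrightarrow>
    tensor_map R V V' W f (pure_tensor R V W v w) = pure_tensor R V' W (f v) w"
  using theI'[OF tensor_map_unique, folded tensor_map_def] by blast

end


section \<open>Splitting off a subspace\<close>

text \<open>Zorn's lemma yields a submodule \<open>C\<close> maximal among those that meet
  \<open>N\<close> only in zero. Maximality forces \<open>C\<close> to meet every coset of
  \<open>N\<close>, which expresses C + N = V in terms of the projection.\<close>

lemma subspace_complement:
  assumes V: "vectorspace K V" and N: "VectorSpace.subspace K N V"
  obtains C where "LinearCombinations.submodule K C V" and "C \<inter> N = {\<zero>\<^bsub>V\<^esub>}"
    and "\<And>x. x \<in> carrier V \<Longrightarrow> \<exists>c\<in>C. quotient_proj V N c = quotient_proj V N x"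
proof -
  interpret V: vectorspace K V by (rule V)
  have subN: "LinearCombinations.submodule K N V"
    using N by (simp add: VectorSpace.subspace_def)
  interpret N: LinearCombinations.submodule K N V by (rule subN)
  let ?q = "quotient_proj V N"
  interpret q: mod_hom K V "quotient_space V N" ?q
    by (rule mod_hom_quotient_proj[OF subN])
  let ?A = "{C. LinearCombinations.submodule K C V \<and> C \<inter> N = {\<zero>\<^bsub>V\<^esub>}}"
  have "LinearCombinations.submodule K {\<zero>\<^bsub>V\<^esub>} V"
    by unfold_locales auto
  then have ne: "?A \<noteq> {}"
    by auto
  have chain: "\<Union>\<C> \<in> ?A" if "\<C> \<noteq> {}" "subset.chain ?A \<C>" for \<C>
  proof -
    have sub: "C \<in> ?A" if "C \<in> \<C>" for C
      using that \<open>subset.chain ?A \<C>\<close> by (auto simp: subset_chain_def)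
    have "LinearCombinations.submodule K (\<Union>\<C>) V"
    proof (rule V.nested_union_vs[of \<C> "\<lambda>C. C"])
      show "\<exists>k. k \<in> \<C> \<and> i \<subseteq> k \<and> j \<subseteq> k" if "i \<in> \<C>" "j \<in> \<C>" for i j
        using that \<open>subset.chain ?A \<C>\<close> unfolding subset_chain_def by (metis order_refl)
    qed (use sub \<open>\<C> \<noteq> {}\<close> in simp_all)
    moreover have "\<Union>\<C> \<inter> N = {\<zero>\<^bsub>V\<^esub>}"
      using sub \<open>\<C> \<noteq> {}\<close> by blast
    ultimately show ?thesis
      by simp
  qed
  have "\<exists>C\<in>?A. \<forall>D\<in>?A. C \<subseteq> D \<longrightarrow> D = C"
    by (rule subset_Zorn_nonempty[OF ne]) (rule chain)
  then obtain C where C: "C \<in> ?A" and max: "\<forall>D\<in>?A. C \<subseteq> D \<longrightarrow> D = C"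
    by (rule bexE) (rule that)
  interpret C: LinearCombinations.submodule K C V
    using C by simp
  have "\<exists>c\<in>C. ?q c = ?q x" if x: "x \<in> carrier V" for x
  proof (rule ccontr)
    assume contr: "\<not> (\<exists>c\<in>C. ?q c = ?q x)"
    \<comment> \<open>If the coset of \<open>x\<close> misses \<open>C\<close>, then
      \<open>D\<close>, which is \<open>C\<close> plus the line through \<open>x\<close>, still
      meets \<open>N\<close> only in zero. It contains \<open>x\<close>, so it contradicts the
      maximality of \<open>C\<close>.\<close>
    define D where "D = {c \<oplus>\<^bsub>V\<^esub> a \<odot>\<^bsub>V\<^esub> x |c a. c \<in> C \<and> a \<in> carrier K}"
    have D_I: "z \<in> D" if "c \<in> C" "a \<in> carrier K" "z = c \<oplus>\<^bsub>V\<^esub> a \<odot>\<^bsub>V\<^esub> x" for z c a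
      using that by (auto simp: D_def)
    have "LinearCombinations.submodule K D V"
    proof
      show "D \<subseteq> carrier V"
        using x C.subset by (auto simp: D_def)
      show "\<zero>\<^bsub>V\<^esub> \<in> D"
        by (rule D_I[OF C.zero_closed V.R.zero_closed]) (use x in simp)
    next
      fix v w assume "v \<in> D" "w \<in> D"
      then obtain c a c' a' where *: "c \<in> C" "a \<in> carrier K" "v = c \<oplus>\<^bsub>V\<^esub> a \<odot>\<^bsub>V\<^esub> x"
        "c' \<in> C" "a' \<in> carrier K" "w = c' \<oplus>\<^bsub>V\<^esub> a' \<odot>\<^bsub>V\<^esub> x"
        by (auto simp: D_def)
      show "v \<oplus>\<^bsub>V\<^esub> w \<in> D"
        by (rule D_I[of "c \<oplus>\<^bsub>V\<^esub> c'" "a \<oplus>\<^bsub>K\<^esub> a'"])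
          (use * x C.subset in \<open>auto simp: V.smult_l_distr V.M.a_ac subset_iff\<close>)
    next
      fix b v assume b: "b \<in> carrier K" and "v \<in> D"
      then obtain c a where *: "c \<in> C" "a \<in> carrier K" "v = c \<oplus>\<^bsub>V\<^esub> a \<odot>\<^bsub>V\<^esub> x"
        by (auto simp: D_def)
      show "b \<odot>\<^bsub>V\<^esub> v \<in> D"
        by (rule D_I[of "b \<odot>\<^bsub>V\<^esub> c" "b \<otimes>\<^bsub>K\<^esub> a"])
          (use * b x C.subset in \<open>auto simp: V.smult_r_distr V.smult_assoc1 subset_iff\<close>)
    qed
    moreover have "D \<inter> N = {\<zero>\<^bsub>V\<^esub>}"
    proof (intro equalityI subsetI)
      fix z assume z: "z \<in> D \<inter> N"
      then obtain c a where *: "c \<in> C" "a \<in> carrier K" "z = c \<oplus>\<^bsub>V\<^esub> a \<odot>\<^bsub>V\<^esub> x"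
        by (auto simp: D_def)
      have c: "c \<in> carrier V"
        using * C.subset by auto
      have 0: "?q c \<oplus>\<^bsub>quotient_space V N\<^esub> a \<odot>\<^bsub>quotient_space V N\<^esub> ?q x = \<zero>\<^bsub>quotient_space V N\<^esub>"
        using z * c x quotient_proj_eq_zero_iff[OF subN, of z] by simp
      \<comment> \<open>An invertible \<open>a\<close> would give x = -(1/a)c modulo
        \<open>N\<close>, so \<open>C\<close> would meet the coset of \<open>x\<close>. This is
        where scalars are inverted. With \<open>a\<close> zero, \<open>z\<close> equals
        \<open>c\<close> and lies in both \<open>C\<close> and \<open>N\<close>.\<close>
      have "a = \<zero>\<^bsub>K\<^esub>"
      proof (rule ccontr)
        assume "a \<noteq> \<zero>\<^bsub>K\<^esub>"
        then have inv: "inv\<^bsub>K\<^esub> a \<in> carrier K" "inv\<^bsub>K\<^esub> a \<otimes>\<^bsub>K\<^esub> a = \<one>\<^bsub>K\<^esub>"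
          using * V.field_Units by auto
        have "a \<odot>\<^bsub>quotient_space V N\<^esub> ?q x = ?q (\<ominus>\<^bsub>V\<^esub> c)"
          using 0 * c x q.N.M.minus_equality[of "a \<odot>\<^bsub>quotient_space V N\<^esub> ?q x" "?q c"]
          by (simp add: q.N.M.a_comm)
        then have "?q x = ?q (inv\<^bsub>K\<^esub> a \<odot>\<^bsub>V\<^esub> (\<ominus>\<^bsub>V\<^esub> c))"
          using inv * c x q.N.smult_assoc1[of "inv\<^bsub>K\<^esub> a" a "?q x"] by simp
        moreover have "inv\<^bsub>K\<^esub> a \<odot>\<^bsub>V\<^esub> (\<ominus>\<^bsub>V\<^esub> c) \<in> C"
          using inv * submodule_additive_subgroup(1)[OF C.submodule_axioms]
          by (auto intro!: C.smult_closed additive_subgroup.a_inv_closed V.M.abelian_group_axioms)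
        ultimately show False
          using contr by auto
      qed
      then show "z \<in> {\<zero>\<^bsub>V\<^esub>}"
        using * c x z C by auto
    qed (auto intro: D_I[OF C.zero_closed V.R.zero_closed] simp: x)
    moreover have "C \<subseteq> D"
      using x C.subset by (auto intro!: D_I[OF _ V.R.zero_closed])
    ultimately have "D = C"
      using max by blast
    moreover have "x \<in> D"
      by (rule D_I[OF C.zero_closed V.R.one_closed]) (use x in simp)
    ultimately show False
      using contr by blast
  qed
  with C show thesis
    by (intro that[of C]) auto
qed

text \<open>The projection maps a complement \<open>C\<close> of \<open>N\<close> bijectively onto
  the quotient, and \<open>s\<close> is the inverse bijection.\<close>

lemma quotient_proj_section:
  assumes V: "vectorspace K V" and N: "VectorSpace.subspace K N V"
  obtains s where "mod_hom K (quotient_space V N) V s"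
    and "\<And>x. x \<in> carrier (quotient_space V N) \<Longrightarrow> quotient_proj V N (s x) = x"
proof -
  have subN: "LinearCombinations.submodule K N V"
    using N by (simp add: VectorSpace.subspace_def)
  let ?q = "quotient_proj V N"
  interpret q: mod_hom K V "quotient_space V N" ?q
    by (rule mod_hom_quotient_proj[OF subN])
  obtain C where C: "LinearCombinations.submodule K C V" and CN: "C \<inter> N = {\<zero>\<^bsub>V\<^esub>}"
    and ex: "\<And>x. x \<in> carrier V \<Longrightarrow> \<exists>c\<in>C. ?q c = ?q x"
    by (rule subspace_complement[OF V N]) (rule that)
  interpret C: LinearCombinations.submodule K C V by (rule C)
  have inj: "inj_on ?q C"
  proof (rule inj_onI)
    fix c d assume cd: "c \<in> C" "d \<in> C" "?q c = ?q d"
    then have "c \<ominus>\<^bsub>V\<^esub> d \<in> C \<inter> N"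
      using C.subset quotient_proj_eq_iff[OF subN, of c d] submodule_minus_closed[OF C] by auto
    then show "c = d"
      using cd C.subset CN by (simp add: subset_iff)
  qed
  have img: "carrier (quotient_space V N) = ?q ` C"
  proof (intro equalityI subsetI)
    fix x assume "x \<in> carrier (quotient_space V N)"
    then obtain v where v: "v \<in> carrier V" "x = ?q v"
      by (auto simp: carrier_quotient_space[OF subN])
    from ex[OF v(1)] show "x \<in> ?q ` C"
      unfolding v(2) by (metis imageI)
  qed (use C.subset in \<open>auto simp: carrier_quotient_space[OF subN]\<close>)
  define s where "s = inv_into C ?q"
  have s: "s x \<in> C" "?q (s x) = x" if "x \<in> carrier (quotient_space V N)" for x
    using that by (simp_all add: img s_def inv_into_into f_inv_into_f)
  \<comment> \<open>The representative in \<open>C\<close> is unique. This yields linearity of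
    \<open>s\<close>: the sum or multiple of representatives in \<open>C\<close> lies in
    \<open>C\<close> and represents the right class.\<close>
  have s_eq: "s x = c" if "c \<in> C" "?q c = x" for c x
    using inv_into_f_eq[OF inj that] by (simp add: s_def)
  have sV: "s x \<in> carrier V" if "x \<in> carrier (quotient_space V N)" for x
    using s(1)[OF that] C.subset by auto
  have "mod_hom K (quotient_space V N) V s"
    by (intro mod_homI q.M.module_axioms q.N.module_axioms s_eq C.m_closed C.smult_closed)
      (auto simp: s sV)
  from this s(2) show thesis by (rule that)
qed


section \<open>Short exact sequences\<close>

definition short_exact ::
    "('k, 'm) ring_scheme \<Rightarrow> ('k, 'a) module \<Rightarrow> ('a \<Rightarrow> 'b) \<Rightarrow> ('k, 'b) module \<Rightarrow> ('b \<Rightarrow> 'c)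
      \<Rightarrow> ('k, 'c) module \<Rightarrow> bool" where
  "short_exact R A f B g C \<longleftrightarrow>
    mod_hom R A B f \<and> mod_hom R B C g \<and> inj_on f (carrier A) \<and>
    f ` carrier A = {x \<in> carrier B. g x = \<zero>\<^bsub>C\<^esub>} \<and> g ` carrier B = carrier C"

text \<open>A diagram chase around the common middle term \<open>A\<close>. Only one direction is
  proved for each property, since the hypotheses are symmetric in the two sequences.\<close>

lemma short_exact_cross:
  assumes QAU: "short_exact R Q S A T U" and A'AB: "short_exact R A' i A p B"
  shows "inj_on (T \<circ> i) (carrier A') \<Longrightarrow> inj_on (p \<circ> S) (carrier Q)"
    and "(T \<circ> i) ` carrier A' = carrier U \<Longrightarrow> (p \<circ> S) ` carrier Q = carrier B"
proof -
  interpret S: mod_hom R Q A S using QAU by (simp add: short_exact_def)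
  interpret T: mod_hom R A U T using QAU by (simp add: short_exact_def)
  interpret i: mod_hom R A' A i using A'AB by (simp add: short_exact_def)
  interpret p: mod_hom R A B p using A'AB by (simp add: short_exact_def)
  have TS: "T (S q) = \<zero>\<^bsub>U\<^esub>" if "q \<in> carrier Q" for q
    using QAU that unfolding short_exact_def by blast
  have pi: "p (i a) = \<zero>\<^bsub>B\<^esub>" if "a \<in> carrier A'" for a
    using A'AB that unfolding short_exact_def by blast
  have kerT: "\<exists>q\<in>carrier Q. x = S q" if "x \<in> carrier A" "T x = \<zero>\<^bsub>U\<^esub>" for x
    using QAU that unfolding short_exact_def by blast
  have kerp: "\<exists>a\<in>carrier A'. x = i a" if "x \<in> carrier A" "p x = \<zero>\<^bsub>B\<^esub>" for x
    using A'AB that unfolding short_exact_def by blast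
  {
    assume inj: "inj_on (T \<circ> i) (carrier A')"
    show "inj_on (p \<circ> S) (carrier Q)"
    proof (rule inj_onI)
      fix q r assume qr: "q \<in> carrier Q" "r \<in> carrier Q" and "(p \<circ> S) q = (p \<circ> S) r"
      \<comment> \<open>The difference is killed by \<open>p\<close>, so it comes from
        \<open>A'\<close>; it is also killed by \<open>T\<close>, because it lies in the image of
        \<open>S\<close>. Injectivity of \<open>T \<circ> i\<close> then makes it zero.\<close>
      then obtain a where a: "a \<in> carrier A'" "S q \<ominus>\<^bsub>A\<^esub> S r = i a"
        using kerp[of "S q \<ominus>\<^bsub>A\<^esub> S r"] by auto
      have "T (i a) = T (i \<zero>\<^bsub>A'\<^esub>)"
        using qr TS by (simp flip: a(2))
      then have "a = \<zero>\<^bsub>A'\<^esub>"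
        using inj_onD[OF inj, of a "\<zero>\<^bsub>A'\<^esub>"] a(1) by simp
      then have "S q = S r"
        using a(2) qr by simp
      then show "q = r"
        using QAU qr by (auto simp: short_exact_def dest: inj_onD)
    qed
  }
  {
    assume surj: "(T \<circ> i) ` carrier A' = carrier U"
    have "\<exists>q\<in>carrier Q. p (S q) = b" if b: "b \<in> carrier B" for b
    proof -
      have "b \<in> p ` carrier A"
        using A'AB b by (simp add: short_exact_def)
      then obtain x where x: "x \<in> carrier A" "p x = b"
        by blast
      have "T x \<in> (T \<circ> i) ` carrier A'"
        using x surj by simp
      then obtain a where a: "a \<in> carrier A'" "T x = T (i a)"
        by auto
      \<comment> \<open>Subtracting \<open>i a\<close> moves \<open>x\<close> into the kernel of
        \<open>T\<close>, which is the image of \<open>S\<close>, and leaves its image under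
        \<open>p\<close> unchanged.\<close>
      then obtain q where q: "q \<in> carrier Q" "x \<ominus>\<^bsub>A\<^esub> i a = S q"
        using kerT[of "x \<ominus>\<^bsub>A\<^esub> i a"] x by auto
      have "p (S q) = b \<ominus>\<^bsub>B\<^esub> \<zero>\<^bsub>B\<^esub>"
        using x a pi by (simp flip: q(2))
      also have "\<dots> = b"
        using b by (rule p.N.M.minus_zero_right)
      finally show ?thesis
        using q(1) by blast
    qed
    then show "(p \<circ> S) ` carrier Q = carrier B"
      by force
  }
qed

text \<open>The converse implications are the same lemma with the two sequences exchanged.
  Injectivity matches injectivity and surjectivity matches surjectivity.\<close>

lemma maximal_rank_cross:
  assumes "short_exact R Q S A T U" "short_exact R A' i A p B"
  shows "maximal_rank A' U (T \<circ> i) \<longleftrightarrow> maximal_rank Q B (p \<circ> S)"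
  using short_exact_cross[OF assms] short_exact_cross[OF assms(2,1)]
  unfolding maximal_rank_def by blast

text \<open>Supplies the sequence for part (a); the inclusion of the kernel is the identity function
  on the smaller carrier.\<close>

lemma short_exact_kernel:
  assumes "mod_hom R A U T" "T ` carrier A = carrier U"
  shows "short_exact R (A\<lparr>carrier := mod_hom.ker A U T\<rparr>) (\<lambda>x. x) A T U"
proof -
  interpret mod_hom R A U T by (rule assms(1))
  have "mod_hom R (A\<lparr>carrier := ker\<rparr>) A (\<lambda>x. x)"
    by (intro mod_homI M.submodule_is_module ker_is_submodule M.module_axioms) (auto simp: ker_def)
  then show ?thesis
    using assms by (auto simp: short_exact_def ker_def)
qed

text \<open>Supplies the sequence for part (b): the coset projection vanishes exactly on the image
  of \<open>S\<close>.\<close>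

lemma short_exact_cokernel:
  assumes "mod_hom R Q A S" "inj_on S (carrier Q)"
  shows "short_exact R Q S A (quotient_proj A (mod_hom.im Q S)) (quotient_space A (mod_hom.im Q S))"
proof -
  interpret mod_hom R Q A S by (rule assms(1))
  have "im \<subseteq> carrier A"
    using im_is_submodule by (rule LinearCombinations.submodule.subset)
  then have "{x \<in> carrier A. quotient_proj A im x = \<zero>\<^bsub>quotient_space A im\<^esub>} = im"
    using quotient_proj_eq_zero_iff[OF im_is_submodule] by blast
  then show ?thesis
    using assms mod_hom_quotient_proj[OF im_is_submodule]
    by (simp add: short_exact_def carrier_quotient_space[OF im_is_submodule]) (simp add: im_def)
qed

text \<open>A splitting consists of a retraction \<open>r\<close> onto \<open>N\<close> and a
  section \<open>s\<close> of the projection. The identities ri = 1, pi = 0, ps = 1 and ir + sp = 1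
  survive tensoring with \<open>W\<close>, being checked on pure tensors, and together they give
  exactness.\<close>

lemma short_exact_tensor:
  assumes V: "vectorspace K V" and N: "VectorSpace.subspace K N V" and W: "Module.module K W"
  shows "short_exact K (tensor_space K (V\<lparr>carrier := N\<rparr>) W)
    (tensor_map K (V\<lparr>carrier := N\<rparr>) V W (\<lambda>v. v)) (tensor_space K V W)
    (tensor_map K V (quotient_space V N) W (quotient_proj V N)) (tensor_space K (quotient_space V N) W)"
proof -
  interpret V: vectorspace K V by (rule V)
  have subN: "LinearCombinations.submodule K N V"
    using N by (simp add: VectorSpace.subspace_def)
  interpret N: LinearCombinations.submodule K N V by (rule subN)
  let ?N = "V\<lparr>carrier := N\<rparr>" and ?Q = "quotient_space V N" and ?q = "quotient_proj V N"
  interpret q: mod_hom K V ?Q ?q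
    by (rule mod_hom_quotient_proj[OF subN])
  obtain s where s: "mod_hom K ?Q V s" and qs: "\<And>x. x \<in> carrier ?Q \<Longrightarrow> ?q (s x) = x"
    using quotient_proj_section[OF V N] by blast
  interpret s: mod_hom K ?Q V s by (rule s)
  \<comment> \<open>The part of \<open>v\<close> left after removing the component in the image of
    \<open>s\<close>. It lies in \<open>N\<close>, because \<open>v\<close> and
    \<open>s (?q v)\<close> have the same class.\<close>
  define r where "r v = v \<ominus>\<^bsub>V\<^esub> s (?q v)" for v
  have r_closed: "r v \<in> N" if "v \<in> carrier V" for v
    using that quotient_proj_eq_iff[OF subN, of v "s (?q v)"] by (simp add: r_def qs)
  have r_id: "r v = v" if "v \<in> N" for v
  proof -
    have "?q v = \<zero>\<^bsub>?Q\<^esub>"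
      using that N.subset by (simp add: quotient_proj_eq_zero_iff[OF subN] subset_iff)
    then show ?thesis
      using that N.subset V.M.minus_zero_right by (simp add: r_def subset_iff)
  qed
  have r: "mod_hom K V ?N r"
  proof (intro mod_homI V.module_axioms V.submodule_is_module subN)
    show "r (x \<oplus>\<^bsub>V\<^esub> y) = r x \<oplus>\<^bsub>?N\<^esub> r y" if "x \<in> carrier V" "y \<in> carrier V" for x y
      using that by (simp add: r_def a_minus_def V.M.minus_add V.M.a_ac)
    show "r (c \<odot>\<^bsub>V\<^esub> x) = c \<odot>\<^bsub>?N\<^esub> r x" if "c \<in> carrier K" "x \<in> carrier V" for c x
      using that by (simp add: r_def a_minus_def V.smult_r_distr V.smult_r_minus)
  qed (simp add: r_closed)
  have i: "mod_hom K ?N V (\<lambda>v. v)"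
    using N.subset by (intro mod_homI V.module_axioms V.submodule_is_module subN) auto
  interpret r: mod_hom K V ?N r by (rule r)
  interpret VW: module_pair K V W by (intro module_pair.intro V.module_axioms W)
  interpret NW: module_pair K ?N W by (intro module_pair.intro r.N.module_axioms W)
  interpret QW: module_pair K ?Q W by (intro module_pair.intro q.N.module_axioms W)
  let ?i = "tensor_map K ?N V W (\<lambda>v. v)" and ?p = "tensor_map K V ?Q W ?q"
    and ?r = "tensor_map K V ?N W r" and ?s = "tensor_map K ?Q V W s"
  interpret ti: mod_hom K NW.VW VW.VW ?i by (rule mod_hom_tensor_map[OF i W])
  interpret tp: mod_hom K VW.VW QW.VW ?p by (rule mod_hom_tensor_map[OF q.mod_hom_axioms W])
  interpret tr: mod_hom K VW.VW NW.VW ?r by (rule mod_hom_tensor_map[OF r W])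
  interpret ts: mod_hom K QW.VW VW.VW ?s by (rule mod_hom_tensor_map[OF s W])
  note map_pure = tensor_map_pure[OF i W] tensor_map_pure[OF q.mod_hom_axioms W]
    tensor_map_pure[OF r W] tensor_map_pure[OF s W]
  have ri: "?r (?i x) = x" if "x \<in> carrier NW.VW" for x
    using that by (induction rule: NW.tensor_induct) (use N.subset in \<open>auto simp: map_pure r_id subset_iff\<close>)
  have pi: "?p (?i x) = \<zero>\<^bsub>QW.VW\<^esub>" if "x \<in> carrier NW.VW" for x
    using that
  proof (induction rule: NW.tensor_induct)
    case (pure v w)
    then have "v \<in> carrier V" "?q v = \<zero>\<^bsub>?Q\<^esub>"
      using N.subset quotient_proj_eq_zero_iff[OF subN, of v] by auto
    then show ?case
      using pure by (simp add: map_pure QW.pure_zero_left)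
  qed auto
  have ps: "?p (?s x) = x" if "x \<in> carrier QW.VW" for x
    using that by (induction rule: QW.tensor_induct) (auto simp: map_pure qs)
  have split: "x = ?i (?r x) \<oplus>\<^bsub>VW.VW\<^esub> ?s (?p x)" if "x \<in> carrier VW.VW" for x
    using that
  proof (induction rule: VW.tensor_induct)
    case (pure v w)
    have v: "r v \<oplus>\<^bsub>V\<^esub> s (?q v) = v"
      using pure(1) by (simp add: r_def a_minus_def V.M.a_assoc V.M.l_neg)
    have "VW.pure (r v) w \<oplus>\<^bsub>VW.VW\<^esub> VW.pure (s (?q v)) w = VW.pure (r v \<oplus>\<^bsub>V\<^esub> s (?q v)) w"
      using pure r_closed[of v] N.subset by (intro VW.pure_add_left[symmetric]) auto
    then show ?case
      using pure r_closed[of v] by (simp add: map_pure v)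
  next
    case (add x y)
    have "?i (?r (x \<oplus>\<^bsub>VW.VW\<^esub> y)) \<oplus>\<^bsub>VW.VW\<^esub> ?s (?p (x \<oplus>\<^bsub>VW.VW\<^esub> y))
      = (?i (?r x) \<oplus>\<^bsub>VW.VW\<^esub> ?s (?p x)) \<oplus>\<^bsub>VW.VW\<^esub> (?i (?r y) \<oplus>\<^bsub>VW.VW\<^esub> ?s (?p y))"
      using add(1,2) by (simp add: VW.T.M.a_ac)
    then show ?case
      unfolding add.IH[symmetric] by simp
  qed
  show ?thesis
    unfolding short_exact_def
  proof (intro conjI ti.mod_hom_axioms tp.mod_hom_axioms equalityI subsetI)
    show "inj_on ?i (carrier NW.VW)"
      by (rule inj_on_inverseI[of _ ?r]) (rule ri)
    \<comment> \<open>When \<open>?p x\<close> is zero, \<open>split\<close> reduces to x = i(r x),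
      so \<open>?r x\<close> is a preimage.\<close>
    show "x \<in> ?i ` carrier NW.VW" if "x \<in> {x \<in> carrier VW.VW. ?p x = \<zero>\<^bsub>QW.VW\<^esub>}" for x
      using that split[of x] by (auto intro!: image_eqI[of _ _ "?r x"])
    show "x \<in> ?p ` carrier VW.VW" if "x \<in> carrier QW.VW" for x
      using that ps by (auto intro!: image_eqI[of _ _ "?s x"])
  qed (auto simp: pi)
qed


section \<open>Finite direct sums\<close>

lemma module_direct_sum_fam:
  assumes "cring R" and "\<And>i. i \<in> I \<Longrightarrow> Module.module R (M i)"
  shows "Module.module R (direct_sum_fam I M)"
proof -
  have M: "abelian_group (M i)" if "i \<in> I" for i
    using assms(2)[OF that] by (rule module.axioms(2))
  note simps = abelian_group.axioms(1)[OF M] abelian_monoid.r_zero abelian_monoid.a_ac abelian_monoid.a_closed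
    abelian_monoid.zero_closed module.smult_closed[OF assms(2)] module.smult_l_distr[OF assms(2)]
    module.smult_r_distr[OF assms(2)] module.smult_assoc1[OF assms(2)] module.smult_one[OF assms(2)]
  show ?thesis
  proof (rule module_criteria)
    show "\<forall>v\<in>carrier (direct_sum_fam I M). \<exists>w\<in>carrier (direct_sum_fam I M).
        v \<oplus>\<^bsub>direct_sum_fam I M\<^esub> w = \<zero>\<^bsub>direct_sum_fam I M\<^esub>"
    proof
      fix v assume v: "v \<in> carrier (direct_sum_fam I M)"
      then show "\<exists>w\<in>carrier (direct_sum_fam I M). v \<oplus>\<^bsub>direct_sum_fam I M\<^esub> w = \<zero>\<^bsub>direct_sum_fam I M\<^esub>"
        by (intro bexI[of _ "\<lambda>i\<in>I. \<ominus>\<^bsub>M i\<^esub> v i"])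
          (auto simp: direct_sum_fam_def fun_eq_iff PiE_iff abelian_group.r_neg[OF M] abelian_group.a_inv_closed[OF M])
    qed
  qed (auto simp: direct_sum_fam_def fun_eq_iff PiE_iff extensional_def assms(1) simps)
qed

lemma mod_hom_direct_sum_map:
  assumes "cring R" and "\<And>i. i \<in> I \<Longrightarrow> mod_hom R (M i) (N i) (f i)"
  shows "mod_hom R (direct_sum_fam I M) (direct_sum_fam I N) (direct_sum_map I f)"
proof -
  have f: "f i \<in> LinearCombinations.module_hom R (M i) (N i)" if "i \<in> I" for i
    using assms(2)[OF that] by (rule mod_hom.f_hom)
  have "Module.module R (M i)" "Module.module R (N i)" if "i \<in> I" for i
    using assms(2)[OF that] by (simp_all add: mod_hom_def)
  then show ?thesis
    by (intro mod_homI module_direct_sum_fam assms(1))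
      (auto simp: direct_sum_map_def direct_sum_fam_def fun_eq_iff PiE_iff f LinearCombinations.module_hom_add[OF f]
        LinearCombinations.module_hom_smult[OF f] funcset_mem[OF LinearCombinations.module_hom_closed[OF f]])
qed

text \<open>Exactness is checked in each component; preimages are chosen component by component and
  assembled into a family.\<close>

lemma short_exact_direct_sum:
  assumes "cring R" and exact: "\<And>i. i \<in> I \<Longrightarrow> short_exact R (A i) (f i) (B i) (g i) (C i)"
  shows "short_exact R (direct_sum_fam I A) (direct_sum_map I f) (direct_sum_fam I B)
    (direct_sum_map I g) (direct_sum_fam I C)"
  unfolding short_exact_def
proof (intro conjI mod_hom_direct_sum_map assms(1))
  show f: "mod_hom R (A i) (B i) (f i)" and g: "mod_hom R (B i) (C i) (g i)" if "i \<in> I" for i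
    using exact[OF that] by (simp_all add: short_exact_def)
  have f_closed: "f i x \<in> carrier (B i)" if "i \<in> I" "x \<in> carrier (A i)" for i x
    using f that by (auto intro: mod_hom.f_im)
  have g_closed: "g i x \<in> carrier (C i)" if "i \<in> I" "x \<in> carrier (B i)" for i x
    using g that by (auto intro: mod_hom.f_im)
  have gf: "g i (f i x) = \<zero>\<^bsub>C i\<^esub>" if "i \<in> I" "x \<in> carrier (A i)" for i x
    using exact[OF that(1)] that(2) unfolding short_exact_def by blast
  show "inj_on (direct_sum_map I f) (carrier (direct_sum_fam I A))"
  proof (rule inj_onI)
    fix x y assume xy: "x \<in> carrier (direct_sum_fam I A)" "y \<in> carrier (direct_sum_fam I A)"
      and eq: "direct_sum_map I f x = direct_sum_map I f y"
    have "x i = y i" if i: "i \<in> I" for i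
    proof -
      have "f i (x i) = f i (y i)"
        using fun_cong[OF eq, of i] i by (simp add: direct_sum_map_def)
      then show ?thesis
        using exact[OF i] xy i by (auto simp: short_exact_def direct_sum_fam_def PiE_iff dest: inj_onD)
    qed
    then show "x = y"
      using xy by (auto simp: direct_sum_fam_def intro: PiE_ext)
  qed
  show "direct_sum_map I f ` carrier (direct_sum_fam I A)
      = {x \<in> carrier (direct_sum_fam I B). direct_sum_map I g x = \<zero>\<^bsub>direct_sum_fam I C\<^esub>}"
  proof (intro equalityI subsetI)
    fix y assume y: "y \<in> {x \<in> carrier (direct_sum_fam I B). direct_sum_map I g x = \<zero>\<^bsub>direct_sum_fam I C\<^esub>}"
    have "\<exists>x\<in>carrier (A i). f i x = y i" if i: "i \<in> I" for i
    proof -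
      have "y i \<in> carrier (B i)" "g i (y i) = \<zero>\<^bsub>C i\<^esub>"
        using y i by (auto simp: direct_sum_fam_def direct_sum_map_def PiE_iff fun_eq_iff split: if_splits)
      then have "y i \<in> f i ` carrier (A i)"
        using exact[OF i] by (simp add: short_exact_def)
      then show ?thesis
        by (metis imageE)
    qed
    then obtain x where x: "\<And>i. i \<in> I \<Longrightarrow> x i \<in> carrier (A i) \<and> f i (x i) = y i"
      by metis
    \<comment> \<open>The chosen family is arbitrary off \<open>I\<close>, whereas elements of the
      direct sum are extensional, hence the restriction to \<open>I\<close>.\<close>
    show "y \<in> direct_sum_map I f ` carrier (direct_sum_fam I A)"
      by (rule image_eqI[of _ _ "restrict x I"])
        (use x y in \<open>auto simp: direct_sum_fam_def direct_sum_map_def PiE_iff fun_eq_iff extensional_def\<close>)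
  qed (auto simp: direct_sum_fam_def direct_sum_map_def PiE_iff f_closed gf)
  show "direct_sum_map I g ` carrier (direct_sum_fam I B) = carrier (direct_sum_fam I C)"
  proof (intro equalityI subsetI)
    fix z assume z: "z \<in> carrier (direct_sum_fam I C)"
    have "\<exists>y\<in>carrier (B i). g i y = z i" if i: "i \<in> I" for i
    proof -
      have "z i \<in> g i ` carrier (B i)"
        using z i exact[OF i] by (auto simp: direct_sum_fam_def PiE_iff short_exact_def)
      then show ?thesis
        by (metis imageE)
    qed
    then obtain y where y: "\<And>i. i \<in> I \<Longrightarrow> y i \<in> carrier (B i) \<and> g i (y i) = z i"
      by metis
    show "z \<in> direct_sum_map I g ` carrier (direct_sum_fam I B)"
      by (rule image_eqI[of _ _ "restrict y I"])
        (use y z in \<open>auto simp: direct_sum_fam_def direct_sum_map_def PiE_iff fun_eq_iff extensional_def\<close>)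
  qed (auto simp: direct_sum_fam_def direct_sum_map_def PiE_iff g_closed)
qed


section \<open>Maximal rank properties\<close>

text \<open>Every open set consists of families of subspaces, so the same dense open set serves for
  both predicates.\<close>

lemma for_general_subspaces_cong:
  assumes "\<And>V'. V' \<in> subspace_families K l V \<Longrightarrow> P V' \<longleftrightarrow> P' V'"
  shows "for_general_subspaces K l V P \<longleftrightarrow> for_general_subspaces K l V P'"
proof -
  have "\<Omega> \<subseteq> subspace_families K l V" if "openin (zariski_grassmannian K l V d) \<Omega>" for \<Omega> d
  proof -
    have "topspace (zariski_grassmannian K l V d) \<subseteq> grassmannian_product K l V d"
      by (auto simp: zariski_grassmannian_def principal_open_def)
    then show ?thesis
      using openin_subset[OF that] by (auto simp: grassmannian_product_def)
  qed
  then show ?thesis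
    unfolding for_general_subspaces_def using assms by (metis subsetD)
qed

lemma short_exact_tensor_sum:
  assumes "field K" and V: "\<And>i. i \<in> {1..l} \<Longrightarrow> vectorspace K (V i)"
    and W: "\<And>i. i \<in> {1..l} \<Longrightarrow> vectorspace K (W i)"
    and V': "V' \<in> subspace_families K l V"
  shows "short_exact K (tensor_sum K l (\<lambda>i. (V i)\<lparr>carrier := V' i\<rparr>) W)
    (tensor_sum_map K l (\<lambda>i. (V i)\<lparr>carrier := V' i\<rparr>) V W (\<lambda>i v. v)) (tensor_sum K l V W)
    (tensor_sum_map K l V (\<lambda>i. quotient_space (V i) (V' i)) W (\<lambda>i. quotient_proj (V i) (V' i)))
    (tensor_sum K l (\<lambda>i. quotient_space (V i) (V' i)) W)"
  unfolding tensor_sum_def tensor_sum_map_def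
proof (rule short_exact_direct_sum)
  show "cring K"
    using assms(1) by (simp add: field_def domain_def)
  show "short_exact K (tensor_space K ((V i)\<lparr>carrier := V' i\<rparr>) (W i))
      (tensor_map K ((V i)\<lparr>carrier := V' i\<rparr>) (V i) (W i) (\<lambda>v. v)) (tensor_space K (V i) (W i))
      (tensor_map K (V i) (quotient_space (V i) (V' i)) (W i) (quotient_proj (V i) (V' i)))
      (tensor_space K (quotient_space (V i) (V' i)) (W i))" if "i \<in> {1..l}" for i
    using V[OF that] W[OF that] V' that
    by (intro short_exact_tensor) (auto simp: subspace_families_def vectorspace_def)
qed

text \<open>The two conditions agree for each single \<open>V'\<close>, so they agree both for all
  and for general choices. Stating this for any short exact sequence with the tensor sum in the
  middle covers (a) and (b) at once.\<close>

lemma left_maximal_rank_duality: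
  assumes K: "field K" and V: "\<forall>i\<in>{1..l}. vectorspace K (V i)" and W: "\<forall>i\<in>{1..l}. vectorspace K (W i)"
    and exact: "short_exact K Q S (tensor_sum K l V W) T U"
  shows "left_omnipresent_from K l V W U T \<longleftrightarrow> left_omnipresent_to K l V W Q S"
    and "left_general_from K l V W U T \<longleftrightarrow> left_general_to K l V W Q S"
proof -
  have *: "restriction_max_rank K l V W U T V' \<longleftrightarrow> projection_max_rank K l V W Q S V'"
    if "V' \<in> subspace_families K l V" for V'
    unfolding restriction_max_rank_def projection_max_rank_def
    by (rule maximal_rank_cross[OF exact short_exact_tensor_sum[OF K V[rule_format] W[rule_format] that]])
  show "left_omnipresent_from K l V W U T \<longleftrightarrow> left_omnipresent_to K l V W Q S"
    using * by (simp add: left_omnipresent_from_def left_omnipresent_to_def)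
  show "left_general_from K l V W U T \<longleftrightarrow> left_general_to K l V W Q S"
    unfolding left_general_from_def left_general_to_def using * by (rule for_general_subspaces_cong)
qed

theorem corollary2p10:
  fixes K :: "('k, 'm) ring_scheme" and l :: nat
    and V :: "nat \<Rightarrow> ('k, 'v) module" and W :: "nat \<Rightarrow> ('k, 'w) module"
    and U :: "('k, 'u) module" and Q :: "('k, 'q) module"
  assumes "algebraically_closed K"
    and "\<And>i. i \<in> {1..l} \<Longrightarrow> fin_dim_space K (V i)"
    and "\<And>i. i \<in> {1..l} \<Longrightarrow> fin_dim_space K (W i)"
    and "fin_dim_space K U" and "fin_dim_space K Q"
  shows
    "(\<forall>T. linear_map K (tensor_sum K l V W) U T \<and>
          T ` carrier (tensor_sum K l V W) = carrier U \<longrightarrow>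
        (let N = (tensor_sum K l V W)\<lparr>carrier := mod_hom.ker (tensor_sum K l V W) U T\<rparr>
         in (left_omnipresent_from K l V W U T \<longleftrightarrow> left_omnipresent_to K l V W N (\<lambda>x. x)) \<and>
            (left_general_from K l V W U T \<longleftrightarrow> left_general_to K l V W N (\<lambda>x. x))))
     \<and>
     (\<forall>S. linear_map K Q (tensor_sum K l V W) S \<and> inj_on S (carrier Q) \<longrightarrow>
        (let C = quotient_space (tensor_sum K l V W) (mod_hom.im Q S);
             p = quotient_proj (tensor_sum K l V W) (mod_hom.im Q S)
         in (left_omnipresent_to K l V W Q S \<longleftrightarrow> left_omnipresent_from K l V W C p) \<and>
            (left_general_to K l V W Q S \<longleftrightarrow> left_general_from K l V W C p)))"
proof -
  have K: "field K" and V: "\<forall>i\<in>{1..l}. vectorspace K (V i)" and W: "\<forall>i\<in>{1..l}. vectorspace K (W i)"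
    using assms by (simp_all add: fin_dim_space_def vectorspace_def)
  \<comment> \<open>Part (a) takes the sequence of the kernel of \<open>T\<close>, part (b) that of
    the cokernel of \<open>S\<close>.\<close>
  note duality = left_maximal_rank_duality[OF K V W]
  show ?thesis
    unfolding Let_def
    by (intro conjI allI impI; elim conjE)
      (simp_all add: linear_map_def duality[OF short_exact_kernel] duality[OF short_exact_cokernel])
qed

end
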